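(* Let $A:\mathbb{R}^n\to\mathbb{R}^{n\times n}$ be symmetric-matrix valued, three times continuously differentiable at every $v\neq 0$, with $A(\alpha v)=A(v)$ for all $\alpha\in\mathbb{R}\setminus\{0\}$; let $J(v):=\frac{\partial}{\partial v}(A(v)v)$ and $p(y):=\frac{y^TA(y)y}{y^Ty}$. Consider the ODE $$y'(t)=p(y(t))y(t)-A(y(t))y(t),\qquad y(0)=y_0,\ \|y_0\|_2=1.$$ Then: (a) $\|y(t)\|_2=1$ for all $t$. (b) Any stationary point of the ODE is a normalized eigenvector of the problem $A(v)v=\lambda v$. (c) Any normalized eigenvector $v$ (i.e., $\|v\|_2=1$ and $A(v)v=\lambda v$ for some $\lambda\in\mathbb{R}$) is a stationary point of the ODE. (d) If $y_*$ is a stationary point and $\lambda_*=p(y_* )$ is a simple eigenvalue of $J(y_* )$ with $\lambda_*<\operatorname{Re}(\mu)$ for all $\mu\in\lambda(J(y_* ))\setminus\{\lambda_*\}$, then $y_*$ is stable. (e) If $y_*$ is a stationary point and there is an eigenvalue $\mu$ of $J(y_* )$ with $\operatorname{Re}(\mu)<\lambda_*=p(y_* )$, then $y_*$ is unstable.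
   Context: $\lambda(M)$ denotes the set of eigenvalues of a matrix $M$; stability refers to stability of the stationary point of the ODE. *)

theory Defs
  imports "HOL-Analysis.Analysis" "HOL-Computational_Algebra.Polynomial"
begin

definition C3_on :: "'a::real_normed_vector set \<Rightarrow> ('a \<Rightarrow> 'b::real_normed_vector) \<Rightarrow> bool" where
  "C3_on S f \<longleftrightarrow>
     (\<exists>D1 D2 D3.
        (\<forall>x\<in>S. (f has_derivative blinfun_apply (D1 x)) (at x)) \<and>
        (\<forall>x\<in>S. (D1 has_derivative blinfun_apply (D2 x)) (at x)) \<and>
        (\<forall>x\<in>S. (D2 has_derivative blinfun_apply (D3 x)) (at x)) \<and>
        continuous_on S D3)"

definition pq :: "(real^'n \<Rightarrow> real^'n^'n) \<Rightarrow> real^'n \<Rightarrow> real" where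
  "pq A y = (y \<bullet> (A y *v y)) / (y \<bullet> y)"

definition odef :: "(real^'n \<Rightarrow> real^'n^'n) \<Rightarrow> real^'n \<Rightarrow> real^'n" where
  "odef A y = pq A y *\<^sub>R y - A y *v y"

definition Jac :: "(real^'n \<Rightarrow> real^'n^'n) \<Rightarrow> real^'n \<Rightarrow> real^'n^'n" where
  "Jac A v = matrix (frechet_derivative (\<lambda>w. A w *v w) (at v))"

definition is_sol :: "(real^'n \<Rightarrow> real^'n^'n) \<Rightarrow> real set \<Rightarrow> (real \<Rightarrow> real^'n) \<Rightarrow> bool" where
  "is_sol A I y \<longleftrightarrow> (\<forall>t\<in>I. (y has_vector_derivative odef A (y t)) (at t within I))"

text \<open>Stationary point of the ODE (on the unit sphere, the phase space of the ODE).\<close>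
definition stationary :: "(real^'n \<Rightarrow> real^'n^'n) \<Rightarrow> real^'n \<Rightarrow> bool" where
  "stationary A y \<longleftrightarrow> norm y = 1 \<and> odef A y = 0"

definition stable :: "(real^'n \<Rightarrow> real^'n^'n) \<Rightarrow> real^'n \<Rightarrow> bool" where
  "stable A ys \<longleftrightarrow>
     (\<forall>\<epsilon>>0. \<exists>\<delta>>0. \<forall>y0. norm y0 = 1 \<and> dist y0 ys < \<delta> \<longrightarrow>
        (\<exists>y. is_sol A {0..} y \<and> y 0 = y0) \<and>
        (\<forall>y. is_sol A {0..} y \<and> y 0 = y0 \<longrightarrow> (\<forall>t\<ge>0. dist (y t) ys < \<epsilon>)))"

definition cmat :: "real^'n^'m \<Rightarrow> complex^'n^'m" where
  "cmat M = (\<chi> i j. complex_of_real (M $ i $ j))"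

definition eigvals :: "real^'n^'n \<Rightarrow> complex set" where
  "eigvals M = {\<mu>. \<exists>x. x \<noteq> 0 \<and> cmat M *v x = \<mu> *s x}"

definition charpoly :: "real^'n^'n \<Rightarrow> complex poly" where
  "charpoly M = det (\<chi> i j. (if i = j then [:0, 1:] else 0) - [:complex_of_real (M $ i $ j):])"

definition simple_eigval :: "real^'n^'n \<Rightarrow> complex \<Rightarrow> bool" where
  "simple_eigval M \<mu> \<longleftrightarrow> \<mu> \<in> eigvals M \<and> order \<mu> (charpoly M) = 1"

end

theory Submission
  imports Defs "HOL-Computational_Algebra.Fundamental_Theorem_Algebra"
begin

text \<open>Write \<open>f\<close> for the vector field, \<open>J\<close> for the Jacobian at a stationary point \<open>y\<close> and \<open>\<lambda> = p(y)\<close>.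
  Since \<open>f\<close> is everywhere orthogonal to the position vector, the sphere is invariant.
  By Euler's identity \<open>J y = \<lambda> y\<close>, and the derivative of \<open>f\<close> at \<open>y\<close> is \<open>B = (1 - y y\<^sup>T)(\<lambda> - J)\<close>, whose
  eigenvalues on \<open>y\<^sup>\<bottom>\<close> are \<open>\<lambda> - \<mu>\<close> for the remaining eigenvalues \<open>\<mu>\<close> of \<open>J\<close>. Simplicity of \<open>\<lambda>\<close> excludes the
  eigenvalue \<open>0\<close> there.

  Stability and instability then follow from linearisation. For a real matrix \<open>M\<close> without eigenvalues
  of real part \<open>\<gamma>\<close> there is a quadratic form \<open>\<beta>\<close> with
  \<open>\<beta>(x, M x) \<ge> \<gamma> \<beta>(x, x) + \<kappa> |x|\<^sup>2\<close>. It is a diagonal form in linear functionals triangularising \<open>M\<close>,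
  with rapidly decreasing coefficients whose signs are those of \<open>Re \<mu> - \<gamma>\<close>. The margin \<open>\<kappa> |x|\<^sup>2\<close> absorbs the nonlinear
  remainder of \<open>f\<close>, so \<open>\<beta>\<close> is a Lyapunov function for \<open>\<gamma> = 0\<close> and a Chetaev function for \<open>\<gamma> > 0\<close>.

  Existence of solutions is global because \<open>f\<close> is homogeneous of degree one and \<open>C\<^sup>1\<close> on the sphere, hence
  globally Lipschitz.\<close>

subsection \<open>Quadratic forms adapted to a matrix\<close>

text \<open>This is \<open>p(D) v\<close> by Horner's scheme, so no matrix powers are
  formed.\<close>

definition poly_apply :: "'a::field^'n^'n \<Rightarrow> 'a^'n \<Rightarrow> 'a poly \<Rightarrow> 'a^'n" where
  "poly_apply D v p = fold_coeffs (\<lambda>a acc. a *s v + D *v acc) p 0"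

lemma poly_apply_0 [simp]: "poly_apply D v 0 = 0"
  by (simp add: poly_apply_def)

lemma poly_apply_pCons [simp]: "poly_apply D v (pCons a p) = a *s v + D *v poly_apply D v p"
  by (cases "a = 0 \<and> p = 0")
    (auto simp: poly_apply_def fold_coeffs_pCons_coeff_not_0_eq fold_coeffs_pCons_not_0_0_eq)

lemma poly_apply_add: "poly_apply D v (p + q) = poly_apply D v p + poly_apply D v q"
proof (induction p arbitrary: q)
  case 0
  then show ?case by simp
next
  case (pCons a p)
  then show ?case
    by (cases q) (simp add: vec.scale_left_distrib matrix_vector_right_distrib)
qed

lemma poly_apply_smult: "poly_apply D v (smult c p) = c *s poly_apply D v p"
  by (induction p)
    (simp_all add: vec.scale_right_distrib vec.scale)

lemma poly_apply_sum: "poly_apply D v (sum f X) = (\<Sum>x\<in>X. poly_apply D v (f x))"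
  by (induction X rule: infinite_finite_induct) (simp_all add: poly_apply_add)

text \<open>The vectors obtained from \<open>v\<close> by 0 to \<open>CARD('n)\<close> applications
  of \<open>D\<close> are too many to be independent; a relation among them is the
  polynomial.\<close>

lemma poly_apply_annihilator:
  fixes D :: "'a::field^'n^'n"
  shows "\<exists>p. p \<noteq> 0 \<and> poly_apply D v p = 0"
proof -
  define e where "e i = poly_apply D v (monom 1 i)" for i
  show ?thesis
  \<comment> \<open>Dependence of a set does not see repetitions, so coinciding iterates are treated
    apart.\<close>
  proof (cases "inj_on e {..CARD('n)}")
    case False
    then obtain i j where ij: "i \<noteq> j" "e i = e j"
      unfolding inj_on_def by blast
    define p :: "'a poly" where "p = monom 1 i + smult (-1) (monom 1 j)"
    have "poly_apply D v p = 0"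
      unfolding p_def poly_apply_add poly_apply_smult using ij(2) by (simp add: e_def)
    moreover have "coeff p i \<noteq> 0"
      using ij by (simp add: p_def)
    then have "p \<noteq> 0" by auto
    ultimately show ?thesis by blast
  next
    case True
    then have "card (e ` {..CARD('n)}) = CARD('n) + 1"
      by (simp add: card_image)
    moreover have "vec.dim (e ` {..CARD('n)}) \<le> CARD('n)"
      by (metis vec.dim_subset_UNIV vec_dim_card vec.dimension_def vec.dim_UNIV)
    ultimately have "vec.dependent (e ` {..CARD('n)})"
      using vec.independent_bound_general[of "e ` {..CARD('n)}"] by linarith
    then obtain u i where u: "i \<le> CARD('n)" "u (e i) \<noteq> 0"
        "(\<Sum>x\<in>e ` {..CARD('n)}. u x *s x) = 0"
      by (auto simp: vec.dependent_finite)
    define p where "p = (\<Sum>j\<le>CARD('n). smult (u (e j)) (monom 1 j))"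
    have "poly_apply D v p = (\<Sum>j\<le>CARD('n). u (e j) *s e j)"
      by (simp add: p_def poly_apply_sum poly_apply_smult e_def)
    also have "\<dots> = 0"
      using u(3) True by (simp add: sum.reindex)
    finally have "poly_apply D v p = 0" .
    moreover have "coeff p i = u (e i)"
      using u(1) by (simp add: p_def coeff_sum if_distrib cong: if_cong)
    then have "p \<noteq> 0" using u(2) by auto
    ultimately show ?thesis by blast
  qed
qed

text \<open>Let \<open>p\<close> have least degree with \<open>p(D) v\<close> in \<open>K\<close>,
  where \<open>v\<close> is outside \<open>K\<close>. Splitting off a root \<mu> leaves a factor
  \<open>r\<close> of lower degree, so \<open>w = r(D) v\<close> is outside \<open>K\<close> while
  \<open>(D - \<mu>) w\<close> is inside.\<close>

lemma quotient_eigenvector: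
  fixes D :: "complex^'n^'n"
  assumes K: "vec.subspace K" "K \<noteq> UNIV"
  obtains w \<mu> where "w \<notin> K" "D *v w - \<mu> *s w \<in> K"
proof -
  obtain v where v: "v \<notin> K" using K(2) by blast
  let ?P = "\<lambda>p. p \<noteq> 0 \<and> poly_apply D v p \<in> K"
  have "\<exists>p. ?P p"
    using poly_apply_annihilator[of D v] vec.subspace_0[OF K(1)] by metis
  then obtain p where p: "?P p" and min: "\<And>q. ?P q \<Longrightarrow> degree p \<le> degree q"
    using ex_has_least_nat[of ?P _ degree] by blast
  have "degree p \<noteq> 0"
  proof
    assume "degree p = 0"
    then obtain c where c: "p = [:c:]"
      by (rule degree_eq_zeroE)
    have "c *s v \<in> K" "c \<noteq> 0"
      using p c by auto
    then show False
      using vec.subspace_scale[OF K(1), of "c *s v" "inverse c"] v by simp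
  qed
  then have "\<not> constant (poly p)"
    by (simp add: constant_degree)
  then obtain \<mu> where "poly p \<mu> = 0"
    using fundamental_theorem_of_algebra by blast
  then obtain r where r: "p = [:- \<mu>, 1:] * r"
    by (metis poly_eq_0_iff_dvd dvdE)
  then have "r \<noteq> 0" using p by auto
  then have "degree p = Suc (degree r)"
    unfolding r by (subst degree_mult_eq) auto
  then have "poly_apply D v r \<notin> K"
    using min[of r] \<open>r \<noteq> 0\<close> by auto
  moreover have "poly_apply D v p = D *v poly_apply D v r - \<mu> *s poly_apply D v r"
  proof -
    have "p = smult (- \<mu>) r + pCons 0 r"
      by (simp add: r)
    then show ?thesis
      by (simp only: poly_apply_add poly_apply_smult poly_apply_pCons) simp
  qed
  ultimately show ?thesis
    using p that by metis
qed

section \<open>Transposed matrices and linear functionals\<close>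

lemma mat_vector_mult: "mat c *v x = c *s (x :: 'a::comm_semiring_1^'n)"
  by (simp add: mat_def matrix_vector_mult_def vec_eq_iff if_distrib if_distribR cong: if_cong)

text \<open>Transposition preserves the determinant, so \<open>C - mat \<mu>\<close> and its
  transpose are singular together.\<close>

lemma eigenvalue_transpose:
  fixes C :: "'a::field^'n^'n"
  assumes "x \<noteq> 0" "transpose C *v x = \<mu> *s x"
  shows "\<exists>z. z \<noteq> 0 \<and> C *v z = \<mu> *s z"
proof -
  have eq: "(M - mat \<mu>) *v z = 0 \<longleftrightarrow> M *v z = \<mu> *s z" for z and M :: "'a^'n^'n"
    by (simp add: matrix_vector_mult_diff_rdistrib mat_vector_mult)
  have "transpose (C - mat \<mu>) = transpose C - mat \<mu>"
    by (simp add: transpose_def mat_def vec_eq_iff)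
  then have "\<not> invertible (transpose (C - mat \<mu>))"
    using assms eq[of "transpose C" x]
    by (metis invertible_left_inverse matrix_left_invertible_ker)
  then have "\<not> invertible (C - mat \<mu>)"
    by (simp add: invertible_det_nz)
  then show ?thesis
    using eq[of C] by (metis invertible_left_inverse matrix_left_invertible_ker)
qed

text \<open>The pairing has no conjugation: it is complex linear in both arguments, and the plain
  transpose is the adjoint with respect to it.\<close>

definition bil :: "complex^'n \<Rightarrow> complex^'n \<Rightarrow> complex" where
  "bil w x = (\<Sum>i\<in>UNIV. w $ i * x $ i)"

lemma bil_add_left: "bil (v + w) x = bil v x + bil w x"
  and bil_diff_left: "bil (v - w) x = bil v x - bil w x"
  and bil_add_right: "bil w (x + y) = bil w x + bil w y"
  and bil_diff_right: "bil w (x - y) = bil w x - bil w y"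
  and bil_scale_left: "bil (c *s w) x = c * bil w x"
  and bil_scale_right: "bil w (c *s x) = c * bil w x"
  and bil_zero_left [simp]: "bil 0 x = 0"
  by (simp_all add: bil_def sum.distrib sum_subtractf sum_distrib_left algebra_simps)

lemma bil_transpose: "bil (transpose C *v w) x = bil w (C *v x)"
proof -
  have "bil (transpose C *v w) x = (\<Sum>i\<in>UNIV. \<Sum>j\<in>UNIV. C $ j $ i * w $ j * x $ i)"
    by (simp add: bil_def matrix_vector_mult_def transpose_def sum_distrib_right)
  also have "\<dots> = (\<Sum>j\<in>UNIV. \<Sum>i\<in>UNIV. C $ j $ i * w $ j * x $ i)"
    by (rule sum.swap)
  also have "\<dots> = bil w (C *v x)"
    by (simp add: bil_def matrix_vector_mult_def sum_distrib_left mult_ac)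
  finally show ?thesis .
qed

text \<open>Bounds the off-diagonal part of a triangular form and, once \<open>S\<close> is a basis,
  the coordinates. Each induction step uses \<open>(a + b)^2 \<le> 2 a^2 + 2 b^2\<close>.\<close>

lemma bil_span_bound:
  assumes "finite S" "k \<in> vec.span S"
  shows "\<exists>C\<ge>0. \<forall>x. (cmod (bil k x))\<^sup>2 \<le> C * (\<Sum>w\<in>S. (cmod (bil w x))\<^sup>2)"
  using assms(2)
proof (induction rule: vec.span_induct_alt)
  case base
  then show ?case by auto
next
  case (step c w k)
  then obtain C where C: "C \<ge> 0" "\<And>x. (cmod (bil k x))\<^sup>2 \<le> C * (\<Sum>w\<in>S. (cmod (bil w x))\<^sup>2)"
    by blast
  let ?C = "2 * ((cmod c)\<^sup>2 + C)"
  have "(cmod (bil (c *s w + k) x))\<^sup>2 \<le> ?C * (\<Sum>w\<in>S. (cmod (bil w x))\<^sup>2)" for x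
  proof -
    have "(cmod (bil (c *s w + k) x))\<^sup>2 \<le> (cmod (c * bil w x) + cmod (bil k x))\<^sup>2"
      by (simp add: bil_add_left bil_scale_left norm_triangle_ineq power_mono)
    also have "\<dots> \<le> 2 * (cmod (c * bil w x))\<^sup>2 + 2 * (cmod (bil k x))\<^sup>2"
      using sum_squares_bound[of "cmod (c * bil w x)" "cmod (bil k x)"] by (simp add: power2_sum)
    also have "(cmod (c * bil w x))\<^sup>2 \<le> (cmod c)\<^sup>2 * (\<Sum>w\<in>S. (cmod (bil w x))\<^sup>2)"
      using member_le_sum[of w S "\<lambda>w. (cmod (bil w x))\<^sup>2"] step.hyps assms(1)
      by (simp add: norm_mult power_mult_distrib mult_left_mono)
    finally show ?thesis
      using C(2)[of x] by (simp add: algebra_simps)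
  qed
  then show ?case
    using C(1) by (intro exI[of _ ?C]) auto
qed

text \<open>A vector \<open>w\<close> stands for the linear functional \<open>bil w\<close>. The form is \<open>\<Sum>w\<in>S. c w * (cmod (bil w x))\<^sup>2\<close>,
  the sum on the left is half its derivative along \<open>x' = C x\<close>, and \<open>pos\<close> records whether positive
  coefficients are allowed.\<close>

definition adapted_form ::
    "complex^'n^'n \<Rightarrow> real \<Rightarrow> bool \<Rightarrow> (complex^'n) set \<Rightarrow> (complex^'n \<Rightarrow> real) \<Rightarrow> real \<Rightarrow> bool" where
  "adapted_form C \<gamma> pos S c \<kappa> \<longleftrightarrow>
    vec.independent S \<and> (\<forall>k\<in>vec.span S. transpose C *v k \<in> vec.span S)
    \<and> (\<forall>w\<in>S. pos \<or> c w < 0) \<and> \<kappa> > 0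
    \<and> (\<forall>x. (\<Sum>w\<in>S. c w * Re (cnj (bil w x) * bil w (C *v x)))
        \<ge> \<gamma> * (\<Sum>w\<in>S. c w * (cmod (bil w x))\<^sup>2) + \<kappa> * (\<Sum>w\<in>S. (cmod (bil w x))\<^sup>2))"

text \<open>The new coefficient \<open>a\<close> is taken so small that the cross term between \<open>w\<close> and the earlier
  functionals is absorbed by the two definite terms.\<close>

lemma adapted_form_step:
  fixes C :: "complex^'n^'n" and \<gamma> :: real
  assumes form: "adapted_form C \<gamma> pos S c \<kappa>"
    and spec: "\<And>\<mu> z. z \<noteq> 0 \<Longrightarrow> C *v z = \<mu> *s z \<Longrightarrow> Re \<mu> \<noteq> \<gamma> \<and> (pos \<or> Re \<mu> < \<gamma>)"
    and full: "vec.span S \<noteq> UNIV"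
  obtains w a \<kappa>' where "w \<notin> vec.span S" "adapted_form C \<gamma> pos (insert w S) (c(w := a)) \<kappa>'"
proof -
  define D where "D = transpose C"
  have S: "vec.independent S" "\<And>k. k \<in> vec.span S \<Longrightarrow> D *v k \<in> vec.span S"
    and c: "\<And>w. w \<in> S \<Longrightarrow> pos \<or> c w < 0"
    and \<kappa>: "\<kappa> > 0"
      "\<And>x. (\<Sum>w\<in>S. c w * Re (cnj (bil w x) * bil w (C *v x)))
        \<ge> \<gamma> * (\<Sum>w\<in>S. c w * (cmod (bil w x))\<^sup>2) + \<kappa> * (\<Sum>w\<in>S. (cmod (bil w x))\<^sup>2)"
    using form unfolding adapted_form_def D_def by blast+
  have fin: "finite S" using S(1) vec.independent_bound_general by blast
  obtain w \<mu> where w: "w \<notin> vec.span S" "D *v w - \<mu> *s w \<in> vec.span S"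
    using quotient_eigenvector[OF vec.subspace_span full] by blast
  define k where "k = D *v w - \<mu> *s w"
  have wS: "w \<notin> S" using w(1) vec.span_base by blast
  have inv: "D *v l \<in> vec.span (insert w S)" if l: "l \<in> vec.span (insert w S)" for l
  proof -
    obtain b where "l - b *s w \<in> vec.span S"
      using l unfolding vec.span_insert by blast
    then have "D *v (l - b *s w) \<in> vec.span S" by (rule S(2))
    then have "D *v (l - b *s w) + b *s k \<in> vec.span S"
      using w(2) unfolding k_def by (intro vec.span_add vec.span_scale)
    then have "D *v l - (b * \<mu>) *s w \<in> vec.span S"
      by (simp add: k_def vec.diff vec.scale vec.scale_right_diff_distrib)
    then show ?thesis unfolding vec.span_insert by blast
  qed
  \<comment> \<open>So far \<mu> is an eigenvalue only modulo \<open>vec.span S\<close>. If it were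
    none of \<open>D\<close>, then \<open>D - mat \<mu>\<close> would be injective and yet send
    \<open>insert w S\<close> into \<open>vec.span S\<close>, whose dimension is one less.\<close>
  have "\<exists>x. x \<noteq> 0 \<and> D *v x = \<mu> *s x"
  proof (rule ccontr)
    assume no: "\<not> ?thesis"
    have lin: "Vector_Spaces.linear (*s) (*s) (\<lambda>x. (D - mat \<mu>) *v x)"
      by simp
    have app: "(D - mat \<mu>) *v x = D *v x - \<mu> *s x" for x
      by (simp add: matrix_vector_mult_diff_rdistrib mat_vector_mult)
    have "inj ((*v) (D - mat \<mu>))"
      unfolding vec.inj_iff_eq_0 using no by (auto simp: app)
    then have "vec.dim ((*v) (D - mat \<mu>) ` insert w S) = vec.dim (insert w S)"
      by (intro vec.dim_image_eq lin) (auto intro: inj_on_subset)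
    moreover have "(*v) (D - mat \<mu>) ` insert w S \<subseteq> vec.span S"
      using w(2) S(2) by (auto simp: app intro!: vec.span_diff vec.span_scale intro: vec.span_base)
    then have "vec.dim ((*v) (D - mat \<mu>) ` insert w S) \<le> vec.dim S"
      by (metis vec.dim_span vec.dim_subset)
    moreover have "vec.dim (insert w S) = Suc (vec.dim S)"
      using w(1) by (simp add: vec.dim_insert)
    ultimately show False by simp
  qed
  then have \<mu>: "Re \<mu> \<noteq> \<gamma>" "pos \<or> Re \<mu> < \<gamma>"
    using eigenvalue_transpose spec unfolding D_def by metis+
  obtain B where B: "B \<ge> 0" "\<And>x. (cmod (bil k x))\<^sup>2 \<le> B * (\<Sum>w\<in>S. (cmod (bil w x))\<^sup>2)"
    using bil_span_bound[OF fin, of k] w(2) unfolding k_def by blast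
  \<comment> \<open>Half the distance to \<gamma>: the diagonal term yields
    \<open>2 * e * \<delta>\<close>, one half of which is spent on the cross term while the other
    half is kept.\<close>
  define \<delta> where "\<delta> = \<bar>Re \<mu> - \<gamma>\<bar> / 2"
  have \<delta>: "\<delta> > 0" using \<mu>(1) by (simp add: \<delta>_def)
  \<comment> \<open>Small enough that the cross term takes at most half of the old margin \<kappa>;
    \<open>B + 1\<close> keeps the denominator positive.\<close>
  define e where "e = \<kappa> * \<delta> / (2 * (B + 1))"
  have "e * B / \<delta> = \<kappa> / 2 * (B / (B + 1))"
    using \<delta> B(1) by (simp add: e_def)
  also have "\<dots> \<le> \<kappa> / 2"
    using \<kappa>(1) B(1) by (intro mult_left_le) auto
  finally have e: "e > 0" "e * B / \<delta> \<le> \<kappa> / 2"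
    using \<kappa>(1) \<delta> B(1) by (simp_all add: e_def)
  \<comment> \<open>The sign makes \<open>a * (Re \<mu> - \<gamma>)\<close> positive on either side
    of \<gamma>.\<close>
  define a where "a = sgn (Re \<mu> - \<gamma>) * e"
  have a: "\<bar>a\<bar> = e" "a * (Re \<mu> - \<gamma>) = 2 * e * \<delta>"
    using e(1) \<mu>(1) by (auto simp: a_def \<delta>_def abs_mult sgn_if)
  define \<kappa>' where "\<kappa>' = min (\<kappa> / 2) (e * \<delta>)"
  have step: "a * Re (cnj (bil w x) * bil w (C *v x))
      \<ge> \<gamma> * (a * (cmod (bil w x))\<^sup>2) + e * \<delta> * (cmod (bil w x))\<^sup>2
        - \<kappa> / 2 * (\<Sum>w\<in>S. (cmod (bil w x))\<^sup>2)" for x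
  proof -
    have "bil w (C *v x) = \<mu> * bil w x + bil k x"
      unfolding k_def D_def by (simp only: bil_diff_left bil_scale_left bil_transpose) simp
    then have "Re (cnj (bil w x) * bil w (C *v x))
        = Re \<mu> * (cmod (bil w x))\<^sup>2 + Re (cnj (bil w x) * bil k x)"
      unfolding cmod_power2 by (simp add: algebra_simps power2_eq_square)
    then have eq: "a * Re (cnj (bil w x) * bil w (C *v x))
        = \<gamma> * (a * (cmod (bil w x))\<^sup>2) + (a * (Re \<mu> - \<gamma>)) * (cmod (bil w x))\<^sup>2
          + a * Re (cnj (bil w x) * bil k x)"
      by (simp add: algebra_simps)
    have "\<bar>Re (cnj (bil w x) * bil k x)\<bar> \<le> cmod (bil w x) * cmod (bil k x)"
      using abs_Re_le_cmod[of "cnj (bil w x) * bil k x"] by (simp add: norm_mult)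
    moreover have "cmod (bil w x) * cmod (bil k x)
        \<le> \<delta> * (cmod (bil w x))\<^sup>2 + (cmod (bil k x))\<^sup>2 / \<delta>"
    proof -
      have "2 * cmod (bil w x) * cmod (bil k x) * \<delta> \<le> (\<delta> * cmod (bil w x))\<^sup>2 + (cmod (bil k x))\<^sup>2"
        using sum_squares_bound[of "\<delta> * cmod (bil w x)" "cmod (bil k x)"] by (simp add: mult_ac)
      then have "2 * (cmod (bil w x) * cmod (bil k x)) \<le> \<delta> * (cmod (bil w x))\<^sup>2 + (cmod (bil k x))\<^sup>2 / \<delta>"
        using \<delta> by (simp add: field_simps power2_eq_square)
      moreover have "0 \<le> cmod (bil w x) * cmod (bil k x)" by simp
      ultimately show ?thesis by linarith
    qed
    ultimately have "\<bar>a * Re (cnj (bil w x) * bil k x)\<bar>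
        \<le> e * (\<delta> * (cmod (bil w x))\<^sup>2 + (cmod (bil k x))\<^sup>2 / \<delta>)"
      unfolding abs_mult a(1) using e(1) by (intro mult_left_mono) auto
    also have "\<dots> = e * \<delta> * (cmod (bil w x))\<^sup>2 + e / \<delta> * (cmod (bil k x))\<^sup>2"
      by (simp add: algebra_simps)
    also have "e / \<delta> * (cmod (bil k x))\<^sup>2 \<le> e / \<delta> * (B * (\<Sum>w\<in>S. (cmod (bil w x))\<^sup>2))"
      using e(1) \<delta> B(2) by (intro mult_left_mono) auto
    also have "\<dots> = (e * B / \<delta>) * (\<Sum>w\<in>S. (cmod (bil w x))\<^sup>2)" by simp
    also have "\<dots> \<le> \<kappa> / 2 * (\<Sum>w\<in>S. (cmod (bil w x))\<^sup>2)"
      using e(2) by (intro mult_right_mono sum_nonneg) auto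
    finally show ?thesis
      unfolding eq a(2) by (simp add: abs_le_iff algebra_simps)
  qed
  have "(\<Sum>v\<in>insert w S. (c(w := a)) v * Re (cnj (bil v x) * bil v (C *v x)))
        \<ge> \<gamma> * (\<Sum>v\<in>insert w S. (c(w := a)) v * (cmod (bil v x))\<^sup>2)
          + \<kappa>' * (\<Sum>v\<in>insert w S. (cmod (bil v x))\<^sup>2)" for x
  proof -
    have upd: "(\<Sum>v\<in>insert w S. (c(w := a)) v * g v) = a * g w + (\<Sum>v\<in>S. c v * g v)" for g
    proof -
      have "(\<Sum>v\<in>S. (c(w := a)) v * g v) = (\<Sum>v\<in>S. c v * g v)"
        using wS by (intro sum.cong) auto
      then show ?thesis using fin wS by simp
    qed
    have "\<kappa>' * (\<Sum>v\<in>insert w S. (cmod (bil v x))\<^sup>2)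
        = \<kappa>' * (cmod (bil w x))\<^sup>2 + \<kappa>' * (\<Sum>w\<in>S. (cmod (bil w x))\<^sup>2)"
      using fin wS by (simp add: algebra_simps)
    also have "\<dots> \<le> e * \<delta> * (cmod (bil w x))\<^sup>2 + \<kappa> / 2 * (\<Sum>w\<in>S. (cmod (bil w x))\<^sup>2)"
      by (intro add_mono mult_right_mono sum_nonneg) (auto simp: \<kappa>'_def)
    finally show ?thesis
      unfolding upd using step[of x] \<kappa>(2)[of x] by (simp add: algebra_simps)
  qed
  moreover have "\<kappa>' > 0" using \<kappa>(1) \<delta> e(1) by (simp add: \<kappa>'_def)
  moreover have "pos \<or> a < 0"
    using \<mu>(2) e(1) by (auto simp: a_def mult_neg_pos)
  moreover have "vec.independent (insert w S)"
    using w(1) S(1) by (rule vec.independent_insertI)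
  moreover have "\<forall>v\<in>insert w S. pos \<or> (c(w := a)) v < 0"
    using c \<open>pos \<or> a < 0\<close> by auto
  ultimately have "adapted_form C \<gamma> pos (insert w S) (c(w := a)) \<kappa>'"
    using inv unfolding adapted_form_def D_def by blast
  with w(1) show ?thesis by (rule that)
qed

text \<open>Start from the empty family and add one functional at a time; at
  \<open>k = CARD('n)\<close> the functionals form a basis.\<close>

lemma adapted_form_exists:
  fixes C :: "complex^'n^'n" and \<gamma> :: real
  assumes spec: "\<And>\<mu> z. z \<noteq> 0 \<Longrightarrow> C *v z = \<mu> *s z \<Longrightarrow> Re \<mu> \<noteq> \<gamma> \<and> (pos \<or> Re \<mu> < \<gamma>)"
    and "k \<le> CARD('n)"
  shows "\<exists>S c \<kappa>. card S = k \<and> adapted_form C \<gamma> pos S c \<kappa>"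
  using assms(2)
proof (induction k)
  case 0
  have "adapted_form C \<gamma> pos {} c 1" for c
    by (simp add: adapted_form_def vec.independent_empty)
  then show ?case using card.empty by blast
next
  case (Suc k)
  then obtain S c \<kappa> where S: "card S = k" "adapted_form C \<gamma> pos S c \<kappa>"
    using Suc_leD by blast
  then have ind: "vec.independent S" by (simp add: adapted_form_def)
  have "vec.span S \<noteq> UNIV"
    using vec.indep_card_eq_dim_span[OF ind] S(1) Suc.prems vec_dim_card[where ?'a=complex]
    by (metis not_less_eq_eq order_refl)
  with S(2) spec obtain w a \<kappa>' where w: "w \<notin> vec.span S"
      "adapted_form C \<gamma> pos (insert w S) (c(w := a)) \<kappa>'"
    by (rule adapted_form_step)
  have "card (insert w S) = Suc k"
    using S(1) w(1) vec.span_base[of w S] vec.independent_bound_general[OF ind]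
    by (metis card_insert_disjoint)
  with w(2) show ?case by blast
qed

section \<open>From complex functionals to real quadratic forms\<close>

definition cvec :: "real^'n \<Rightarrow> complex^'n" where
  "cvec x = (\<chi> i. complex_of_real (x $ i))"

lemma cvec_nth [simp]: "cvec x $ i = complex_of_real (x $ i)"
  by (simp add: cvec_def)

lemma cmat_mult_cvec: "cmat M *v cvec x = cvec (M *v x)"
  by (simp add: vec_eq_iff cmat_def matrix_vector_mult_def)

lemma bil_cvec_add: "bil w (cvec (x + y)) = bil w (cvec x) + bil w (cvec y)"
  by (simp add: bil_def sum.distrib algebra_simps)

lemma bil_cvec_scaleR: "bil w (cvec (r *\<^sub>R x)) = r * bil w (cvec x)"
  by (simp add: bil_def sum_distrib_left algebra_simps)

text \<open>For the flow of \<open>x' = M x\<close>, \<open>\<beta> x x\<close> is a Lyapunov function if \<open>\<gamma> = 0\<close> and all eigenvalues have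
  negative real part, and a Chetaev function if \<open>\<gamma> > 0\<close>.\<close>

lemma lyapunov_form:
  fixes M :: "real^'n^'n" and \<gamma> :: real
  assumes spec: "\<And>\<mu>. \<mu> \<in> eigvals M \<Longrightarrow> Re \<mu> \<noteq> \<gamma>"
  obtains \<beta> :: "real^'n \<Rightarrow> real^'n \<Rightarrow> real" and \<kappa> :: real
  where "bounded_bilinear \<beta>" "\<And>x y. \<beta> x y = \<beta> y x" "\<kappa> > 0"
    "\<And>x. \<beta> x (M *v x) \<ge> \<gamma> * \<beta> x x + \<kappa> * (norm x)\<^sup>2"
    "\<And>x. (\<forall>\<mu>\<in>eigvals M. Re \<mu> < \<gamma>) \<Longrightarrow> x \<noteq> 0 \<Longrightarrow> \<beta> x x < 0"
proof -
  \<comment> \<open>If all eigenvalues lie to the left of \<gamma>, \<open>pos\<close> is false and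
    all coefficients come out negative, which gives the definiteness claim.\<close>
  define pos where "pos \<longleftrightarrow> (\<exists>\<mu>\<in>eigvals M. \<not> Re \<mu> < \<gamma>)"
  have spec': "Re \<mu> \<noteq> \<gamma> \<and> (pos \<or> Re \<mu> < \<gamma>)" if "z \<noteq> 0" "cmat M *v z = \<mu> *s z" for \<mu> z
  proof -
    have "\<mu> \<in> eigvals M" using that by (auto simp: eigvals_def)
    then show ?thesis using spec by (auto simp: pos_def)
  qed
  have "\<exists>S c \<kappa>. card S = CARD('n) \<and> adapted_form (cmat M) \<gamma> pos S c \<kappa>"
    by (rule adapted_form_exists[OF _ order_refl]) (rule spec')
  then obtain S c \<kappa>
    where card: "card S = CARD('n)" and form: "adapted_form (cmat M) \<gamma> pos S c \<kappa>"
    by blast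
  then have S: "card S = CARD('n)" "vec.independent S"
      "\<forall>w\<in>S. pos \<or> c w < 0" "\<kappa> > 0"
      "\<forall>x. (\<Sum>w\<in>S. c w * Re (cnj (bil w x) * bil w (cmat M *v x)))
        \<ge> \<gamma> * (\<Sum>w\<in>S. c w * (cmod (bil w x))\<^sup>2) + \<kappa> * (\<Sum>w\<in>S. (cmod (bil w x))\<^sup>2)"
    unfolding adapted_form_def by blast+
  have fin: "finite S" using S(2) vec.independent_bound_general by blast
  have full: "vec.span S = UNIV"
  proof (rule ccontr)
    assume "vec.span S \<noteq> UNIV"
    then have "vec.dim S < vec.dim (UNIV :: (complex^'n) set)"
      by (intro vec.dim_psubset) (auto simp: vec.span_UNIV)
    then show False
      using vec.indep_card_eq_dim_span[OF S(2)] S(1) vec_dim_card[where ?'a=complex and ?'n='n]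
      by (simp only: vec.dim_span)
  qed
  define N where "N x = (\<Sum>w\<in>S. (cmod (bil w (cvec x)))\<^sup>2)" for x :: "real^'n"
  \<comment> \<open>\<open>S\<close> spans, so each coordinate functional \<open>axis i 1\<close> is
    controlled by \<open>S\<close>; summing over \<open>i\<close>, a multiple of \<open>N\<close>
    dominates the squared norm.\<close>
  have "\<exists>B\<ge>0. \<forall>x. (x $ i)\<^sup>2 \<le> B * N x" for i
  proof -
    obtain B where B: "B \<ge> 0"
        "\<forall>x. (cmod (bil (axis i 1) x))\<^sup>2 \<le> B * (\<Sum>w\<in>S. (cmod (bil w x))\<^sup>2)"
      using bil_span_bound[OF fin, of "axis i 1"] full by auto
    have "bil (axis i 1) (cvec x) = x $ i" for x
      by (simp add: bil_def axis_def if_distrib if_distribR cong: if_cong)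
    then have "(x $ i)\<^sup>2 \<le> B * N x" for x
      using B(2)[rule_format, of "cvec x"] by (simp add: N_def)
    then show ?thesis using B(1) by blast
  qed
  then obtain B where B: "\<And>i. B i \<ge> 0" "\<And>i x. (x $ i)\<^sup>2 \<le> B i * N x"
    by metis
  have N0: "N x \<ge> 0" for x by (simp add: N_def sum_nonneg)
  have N: "(norm x)\<^sup>2 \<le> (sum B UNIV + 1) * N x" for x
  proof -
    have "(norm x)\<^sup>2 = (\<Sum>i\<in>UNIV. (x $ i)\<^sup>2)"
      by (simp add: norm_vec_def L2_set_def sum_nonneg)
    also have "\<dots> \<le> sum B UNIV * N x"
      unfolding sum_distrib_right by (intro sum_mono B)
    also have "\<dots> \<le> (sum B UNIV + 1) * N x"
      using N0 by (intro mult_right_mono) auto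
    finally show ?thesis .
  qed
  have B1: "sum B UNIV + 1 > 0" using B(1) by (simp add: add_nonneg_pos sum_nonneg)
  define \<beta> where "\<beta> x y = (\<Sum>w\<in>S. c w * Re (cnj (bil w (cvec x)) * bil w (cvec y)))"
    for x y :: "real^'n"
  have diag: "\<beta> x x = (\<Sum>w\<in>S. c w * (cmod (bil w (cvec x)))\<^sup>2)" for x
    unfolding \<beta>_def cmod_power2 by (simp add: power2_eq_square)
  show ?thesis
  proof (rule that[of \<beta> "\<kappa> / (sum B UNIV + 1)"])
    show "bounded_bilinear \<beta>"
      unfolding bilinear_conv_bounded_bilinear[symmetric] bilinear_def \<beta>_def
      by (auto intro!: linearI simp: bil_cvec_add bil_cvec_scaleR algebra_simps
          sum.distrib sum_distrib_left)
    show "\<beta> x y = \<beta> y x" for x y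
      by (simp add: \<beta>_def algebra_simps)
    show "\<kappa> / (sum B UNIV + 1) > 0" using S(4) B1 by simp
    show "\<beta> x (M *v x) \<ge> \<gamma> * \<beta> x x + \<kappa> / (sum B UNIV + 1) * (norm x)\<^sup>2" for x
    proof -
      have "\<kappa> / (sum B UNIV + 1) * (norm x)\<^sup>2 \<le> \<kappa> * N x"
        using mult_left_mono[OF N[of x], of \<kappa>] B1 S(4) by (simp add: field_simps)
      then show ?thesis
        using S(5)[rule_format, of "cvec x"]
        unfolding diag N_def by (simp add: \<beta>_def cmat_mult_cvec)
    qed
    show "\<beta> x x < 0" if neg: "\<forall>\<mu>\<in>eigvals M. Re \<mu> < \<gamma>" and "x \<noteq> 0" for x
    proof -
      have c: "c w < 0" if "w \<in> S" for w
        using neg that S(3) by (auto simp: pos_def)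
      have "(norm x)\<^sup>2 > 0" using \<open>x \<noteq> 0\<close> by simp
      then have "N x > 0"
        using N[of x] B1 by (metis less_le_trans zero_less_mult_pos)
      then obtain w where w: "w \<in> S" "(cmod (bil w (cvec x)))\<^sup>2 > 0"
        unfolding N_def by (metis less_irrefl sum_nonpos not_less)
      have "0 < (\<Sum>w\<in>S. - (c w * (cmod (bil w (cvec x)))\<^sup>2))"
      proof (rule sum_pos2[OF fin w(1)])
        show "0 < - (c w * (cmod (bil w (cvec x)))\<^sup>2)"
          using c[OF w(1)] w(2) by (simp add: mult_neg_pos del: zero_less_power2)
        show "0 \<le> - (c v * (cmod (bil v (cvec x)))\<^sup>2)" if "v \<in> S" for v
          using c[OF that] by (simp add: mult_nonpos_nonneg)
      qed
      then show ?thesis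
        unfolding diag by (simp add: sum_negf)
    qed
  qed
qed

subsection \<open>Eigenvalues of the linearised field\<close>

lemma poly_det:
  fixes A :: "'a::comm_ring_1 poly^'n^'n"
  shows "poly (det A) t = det (\<chi> i j. poly (A $ i $ j) t)"
  by (simp add: det_def poly_sum poly_prod)

lemma poly_charpoly: "poly (charpoly M) t = det (mat t - cmat M)"
  unfolding charpoly_def poly_det
  by (rule arg_cong[of _ _ det]) (simp add: vec_eq_iff mat_def cmat_def)

lemma det_eq_0_iff_kernel:
  fixes C :: "'a::field^'n^'n"
  shows "det C = 0 \<longleftrightarrow> (\<exists>x. x \<noteq> 0 \<and> C *v x = 0)"
  by (metis invertible_det_nz invertible_left_inverse matrix_left_invertible_ker)

lemma mat_minus_mult: "(mat t - C) *v x = t *s x - C *v (x :: 'a::field^'n)"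
  by (simp add: matrix_vector_mult_diff_rdistrib mat_vector_mult)

lemma eigvals_iff_root: "\<mu> \<in> eigvals M \<longleftrightarrow> poly (charpoly M) \<mu> = 0"
  unfolding poly_charpoly det_eq_0_iff_kernel eigvals_def mat_minus_mult mem_Collect_eq
  by (metis right_minus_eq)

text \<open>Otherwise every complex number would be an eigenvalue, in particular one beyond the
  operator bound of \<open>cmat M\<close>.\<close>

lemma charpoly_nonzero: "charpoly M \<noteq> 0"
proof
  assume "charpoly M = 0"
  then have all: "\<mu> \<in> eigvals M" for \<mu>
    by (simp add: eigvals_iff_root)
  obtain K where K: "K > 0" "\<And>x. norm (cmat M *v x) \<le> norm x * K"
    using bounded_linear.pos_bounded[OF matrix_vector_mul_bounded_linear[of "cmat M"]] by auto
  obtain x where x: "x \<noteq> 0" "cmat M *v x = complex_of_real (K + 1) *s x"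
    using all[of "complex_of_real (K + 1)"] by (auto simp: eigvals_def)
  have "complex_of_real (K + 1) *s x = (K + 1) *\<^sub>R x"
    by (simp add: vec_eq_iff scaleR_conv_of_real[where 'a=complex] algebra_simps)
  then have "(K + 1) * norm x \<le> norm x * K"
    using K(2)[of x] x(2) K(1) by simp
  then show False using x(1) by (simp add: algebra_simps)
qed

lemma finite_eigvals: "finite (eigvals M)"
proof -
  have "eigvals M = {\<mu>. poly (charpoly M) \<mu> = 0}"
    using eigvals_iff_root by auto
  then show ?thesis using poly_roots_finite[OF charpoly_nonzero] by simp
qed

text \<open>Cramer's rule for the eigenvector \<open>y\<close> pulls one factor \<open>t - l\<close> out of the characteristic
  polynomial; the cofactor still vanishes at \<open>l\<close> because of \<open>z\<close>.\<close>

lemma generalized_eigenvector_order: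
  fixes M :: "real^'n^'n"
  assumes y: "y \<noteq> 0" "cmat M *v y = l *s y"
    and z: "cmat M *v z = l *s z + a *s y" "\<And>c. z \<noteq> c *s y"
  shows "order l (charpoly M) \<noteq> 1"
proof -
  let ?C = "cmat M"
  obtain k where k: "y $ k \<noteq> 0" using y(1) by (auto simp: vec_eq_iff)
  \<comment> \<open>\<open>N t\<close> is \<open>mat t - ?C\<close> with column \<open>k\<close>
    replaced by \<open>y\<close>, as in Cramer's rule, and \<open>P\<close> is its determinant as a
    polynomial in \<open>t\<close>.\<close>
  define N where "N t = (\<chi> i j. if j = k then y $ i else (mat t - ?C) $ i $ j)" for t
  define P where "P = det ((\<chi> i j. if j = k then [:y $ i:] else
    (if i = j then [:0, 1:] else 0) - [:complex_of_real (M $ i $ j):]) :: complex poly^'n^'n)"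
  have polyP: "poly P t = det (N t)" for t
    unfolding P_def poly_det
    by (rule arg_cong[of _ _ det]) (simp add: vec_eq_iff mat_def cmat_def N_def)
  have "poly ([:- l, 1:] * P) t = poly (smult (y $ k) (charpoly M)) t" for t
  proof (cases "t = l")
    case True
    have "l \<in> eigvals M" using y by (auto simp: eigvals_def)
    then show ?thesis using True by (simp add: eigvals_iff_root)
  next
    case False
    \<comment> \<open>The solution of \<open>(mat t - ?C) *v x = y\<close>, explicit because
      \<open>y\<close> is an eigenvector.\<close>
    define x where "x = (1 / (t - l)) *s y"
    have "(mat t - ?C) *v y = (t - l) *s y"
      by (simp only: mat_minus_mult y(2) vec.scale_left_diff_distrib)
    then have "(mat t - ?C) *v x = (1 / (t - l)) *s ((t - l) *s y)"
      by (simp only: x_def vec.scale)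
    moreover have "1 / (t - l) * (t - l) = 1"
      using False by simp
    ultimately have Ex: "(mat t - ?C) *v x = y"
      by (simp only: vec.scale_scale vec.scale_one)
    have "poly P t = x $ k * poly (charpoly M) t"
      unfolding polyP poly_charpoly N_def using cramer_lemma[of k "mat t - ?C" x]
      by (simp only: Ex)
    moreover have "(t - l) * x $ k = y $ k"
      using False by (simp add: x_def)
    ultimately have "(t - l) * poly P t = y $ k * poly (charpoly M) t"
      by (metis mult.assoc)
    then show ?thesis by (simp add: algebra_simps)
  qed
  then have eq: "[:- l, 1:] * P = smult (y $ k) (charpoly M)"
    by (simp add: poly_eq_poly_eq_iff[symmetric] fun_eq_iff)
  have "poly P l = 0"
    unfolding polyP det_eq_0_iff_kernel
  proof (intro exI conjI)
    \<comment> \<open>\<open>z\<close> freed of its entry at \<open>k\<close>, so that the replaced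
      column does not act on it. What \<open>mat l - ?C\<close> leaves is a multiple of
      \<open>y\<close>, cancelled by that column through \<open>axis k a\<close>.\<close>
    define w where "w = z - (z $ k / y $ k) *s y"
    have wk: "w $ k = 0" using k by (simp add: w_def)
    have Ew: "(mat l - ?C) *v w = - (a *s y)"
      by (simp add: w_def mat_minus_mult vec.diff vec.scale y(2) z(1)
          vec.scale_right_diff_distrib mult.commute)
    have "N l *v w = (mat l - ?C) *v w"
      unfolding matrix_vector_mult_def vec_eq_iff
      by (auto simp: N_def wk intro!: sum.cong)
    moreover have "N l *v axis k a = a *s y"
      by (simp add: matrix_vector_mult_def vec_eq_iff N_def axis_def mult.commute
          if_distrib if_distribR cong: if_cong)
    ultimately show "N l *v (w + axis k a) = 0"
      using Ew by (simp add: matrix_vector_right_distrib)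
    show "w + axis k a \<noteq> 0"
    proof
      assume "w + axis k a = 0"
      then have "w $ j + (if j = k then a else 0) = 0" for j
        by (auto simp: vec_eq_iff axis_def split: if_splits)
      then have "w $ j = 0" for j using wk by (metis add.right_neutral)
      then have "w = 0" by (simp add: vec_eq_iff)
      then show False using z(2)[of "z $ k / y $ k"] by (simp add: w_def)
    qed
  qed
  then have "[:- l, 1:] dvd P" by (simp add: poly_eq_0_iff_dvd)
  then have "[:- l, 1:] * [:- l, 1:] dvd smult (y $ k) (charpoly M)"
    unfolding eq[symmetric] by (rule mult_dvd_mono[OF dvd_refl])
  then have "[:- l, 1:] ^ 2 dvd charpoly M"
    using k by (simp add: dvd_smult_iff power2_eq_square)
  then have "2 \<le> order l (charpoly M)"
    using charpoly_nonzero[of M] unfolding order_divides by blast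
  then show ?thesis by simp
qed

text \<open>For \<open>s = 0\<close> this is the derivative of the vector field at a stationary point \<open>y\<close>; the term
  with \<open>s\<close> moves the eigenvalue in the direction \<open>y\<close>, normal to the sphere, from \<open>0\<close> to \<open>- s\<close>.\<close>

definition lin_field :: "real^'n^'n \<Rightarrow> real^'n \<Rightarrow> real \<Rightarrow> real \<Rightarrow> real^'n^'n" where
  "lin_field J y l s = mat l - J + (\<chi> i j. y $ i * (transpose J *v y - (l + s) *\<^sub>R y) $ j)"

lemma outer_mult: "(\<chi> i j. a $ i * b $ j) *v h = (b \<bullet> h) *\<^sub>R (a :: real^'n)"
  by (simp add: matrix_vector_mult_def inner_vec_def vec_eq_iff sum_distrib_left mult_ac)

lemma cmat_outer_mult: "cmat (\<chi> i j. a $ i * b $ j) *v x = bil (cvec b) x *s cvec a"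
  by (simp add: cmat_def matrix_vector_mult_def bil_def vec_eq_iff sum_distrib_left mult_ac)

lemma lin_field_mult:
  "lin_field J y l s *v h = l *\<^sub>R h - J *v h + (y \<bullet> (J *v h) - (l + s) * (y \<bullet> h)) *\<^sub>R y"
  unfolding lin_field_def matrix_vector_mult_add_rdistrib outer_mult mat_minus_mult
  by (simp only: inner_diff_left inner_scaleR_left scalar_mult_eq_scaleR dot_lmul_matrix
      vector_transpose_matrix[symmetric] transpose_transpose)

lemma cmat_lin_field_mult:
  fixes J :: "real^'n^'n"
  shows "cmat (lin_field J y l s) *v x = of_real l *s x - cmat J *v x
    + (bil (cvec y) (cmat J *v x) - of_real (l + s) * bil (cvec y) x) *s cvec y"
proof -
  have 1: "cmat (mat l - J + Q) = mat (of_real l) - cmat J + cmat Q" for Q :: "real^'n^'n"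
    by (simp add: cmat_def mat_def vec_eq_iff)
  have 2: "bil (cvec (transpose J *v y)) x = bil (cvec y) (cmat J *v x)"
  proof -
    have "cvec (transpose J *v y) = transpose (cmat J) *v cvec y"
      by (simp only: cmat_mult_cvec[symmetric]) (simp add: cmat_def transpose_def)
    then show ?thesis by (simp only: bil_transpose)
  qed
  have "cvec (transpose J *v y - (l + s) *\<^sub>R y) = cvec (transpose J *v y) - of_real (l + s) *s cvec y"
    by (simp add: vec_eq_iff algebra_simps)
  then have "bil (cvec (transpose J *v y - (l + s) *\<^sub>R y)) x
      = bil (cvec y) (cmat J *v x) - of_real (l + s) * bil (cvec y) x"
    by (simp only: bil_diff_left bil_scale_left 2)
  then show ?thesis
    unfolding lin_field_def 1 matrix_vector_mult_add_rdistrib mat_minus_mult cmat_outer_mult by simp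
qed

lemma bil_cvec_cvec: "bil (cvec x) (cvec y) = of_real (x \<bullet> y)"
  by (simp add: bil_def inner_vec_def)

text \<open>\<open>y\<close> is a left eigenvector for \<open>- s\<close>, so
  \<open>bil (cvec y)\<close> annihilates the eigenvectors of all other eigenvalues.\<close>

lemma bil_cvec_cmat_lin_field:
  assumes "norm y = 1"
  shows "bil (cvec y) (cmat (lin_field J y l s) *v x) = - of_real s * bil (cvec y) x"
proof -
  have "bil (cvec y) (cvec y) = 1"
    using assms by (simp add: bil_cvec_cvec dot_square_norm)
  then show ?thesis
    unfolding cmat_lin_field_mult
    by (simp add: bil_add_right bil_diff_right bil_scale_right algebra_simps)
qed

text \<open>Unless \<nu> is \<open>- 1\<close>, its eigenvector \<open>z\<close> is orthogonal to
  \<open>y\<close>, and \<open>z\<close> is an eigenvector of \<open>J\<close> for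
  \<open>l - \<nu>\<close> up to a multiple of \<open>y\<close>. Correcting \<open>z\<close> by a
  multiple of \<open>y\<close> makes it a true one, to which the gap applies.\<close>

lemma lin_field_eigenvalue_neg:
  assumes y: "norm y = 1" "J *v y = l *\<^sub>R y"
    and simple: "simple_eigval J (complex_of_real l)"
    and gap: "\<forall>\<mu>\<in>eigvals J - {complex_of_real l}. l < Re \<mu>"
    and \<nu>: "\<nu> \<in> eigvals (lin_field J y l 1)"
  shows "Re \<nu> < 0"
proof -
  obtain z where z: "z \<noteq> 0" "cmat (lin_field J y l 1) *v z = \<nu> *s z"
    using \<nu> by (auto simp: eigvals_def)
  let ?y = "cvec y" and ?l = "complex_of_real l"
  have yy: "bil ?y ?y = 1" using y(1) by (simp add: bil_cvec_cvec dot_square_norm)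
  have Cy: "cmat J *v ?y = ?l *s ?y"
    using y(2) by (simp add: cmat_mult_cvec) (simp add: vec_eq_iff)
  have "- bil ?y z = \<nu> * bil ?y z"
    using bil_cvec_cmat_lin_field[OF y(1), of J l 1 z] z(2) by (simp add: bil_scale_right)
  then have "(\<nu> + 1) * bil ?y z = 0" by (simp only: distrib_right mult_1) (metis add.left_inverse)
  then consider "\<nu> = - 1" | "bil ?y z = 0" by (auto simp: eq_neg_iff_add_eq_0)
  then show ?thesis
  proof cases
    case 2
    define a where "a = bil ?y (cmat J *v z)"
    have "?l *s z - cmat J *v z + a *s ?y = \<nu> *s z"
      using z(2) 2 by (simp add: cmat_lin_field_mult a_def)
    then have Cz: "cmat J *v z = (?l - \<nu>) *s z + a *s ?y"
      by (simp add: vec.scale_left_diff_distrib algebra_simps)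
    have indep: "z \<noteq> c *s ?y" for c
    proof
      assume "z = c *s ?y"
      then have "c = 0" using 2 yy by (simp add: bil_scale_right)
      then show False using z(1) \<open>z = c *s ?y\<close> by simp
    qed
    \<comment> \<open>For \<nu> = 0, \<open>z\<close> would be a second eigenvector or a generalized
      eigenvector of \<open>J\<close> at \<open>l\<close>, against simplicity.\<close>
    have "\<nu> \<noteq> 0"
    proof
      assume "\<nu> = 0"
      have "?y \<noteq> 0" using yy by auto
      moreover have "cmat J *v z = ?l *s z + a *s ?y" using Cz \<open>\<nu> = 0\<close> by simp
      ultimately show False
        using generalized_eigenvector_order[OF _ Cy _ indep] simple
        by (simp add: simple_eigval_def)
    qed
    define x where "x = z - (a / \<nu>) *s ?y"
    have "cmat J *v x = (?l - \<nu>) *s x"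
      using \<open>\<nu> \<noteq> 0\<close>
      by (simp add: x_def vec.diff vec.scale Cz Cy vec_eq_iff field_simps)
    moreover have "x \<noteq> 0" using indep[of "a / \<nu>"] by (simp add: x_def)
    ultimately have "?l - \<nu> \<in> eigvals J" by (auto simp: eigvals_def)
    then have "l < Re (?l - \<nu>)" using gap \<open>\<nu> \<noteq> 0\<close> by (intro bspec[OF gap]) auto
    then show ?thesis by simp
  qed simp
qed

lemma eigenvector_Re_Im:
  assumes "cmat M *v x = \<nu> *s x"
  defines "a \<equiv> \<chi> i. Re (x $ i)" and "b \<equiv> \<chi> i. Im (x $ i)"
  shows "M *v a = Re \<nu> *\<^sub>R a - Im \<nu> *\<^sub>R b" "M *v b = Re \<nu> *\<^sub>R b + Im \<nu> *\<^sub>R a"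
proof -
  have *: "(\<Sum>j\<in>UNIV. of_real (M $ i $ j) * x $ j) = \<nu> * x $ i" for i
    using assms(1) by (simp add: vec_eq_iff matrix_vector_mult_def cmat_def)
  show "M *v a = Re \<nu> *\<^sub>R a - Im \<nu> *\<^sub>R b" "M *v b = Re \<nu> *\<^sub>R b + Im \<nu> *\<^sub>R a"
    using arg_cong[OF *, of Re] arg_cong[OF *, of Im]
    by (auto simp: a_def b_def vec_eq_iff matrix_vector_mult_def Re_sum Im_sum)
qed

text \<open>The eigenvector of \<open>J\<close> for \<mu>, projected along \<open>y\<close>, is a
  tangential eigenvector of \<open>lin_field J y l 0\<close> for \<open>l - \<mu>\<close>. The form
  is positive on its real or on its imaginary part, and that part is \<open>d\<close>.\<close>

lemma unstable_direction:
  fixes J :: "real^'n^'n"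
  assumes y: "norm y = 1" "J *v y = l *\<^sub>R y"
    and \<mu>: "\<mu> \<in> eigvals J" "Re \<mu> < l"
  obtains \<beta> \<kappa> \<gamma> d where "bounded_bilinear \<beta>" "\<And>x y. \<beta> x y = \<beta> y x" "\<kappa> > 0" "\<gamma> > 0"
    "\<And>x. \<beta> x (lin_field J y l 0 *v x) \<ge> \<gamma> * \<beta> x x + \<kappa> * (norm x)\<^sup>2"
    "y \<bullet> d = 0" "\<beta> d d > 0"
proof -
  let ?B = "lin_field J y l 0" and ?y = "cvec y" and ?l = "complex_of_real l"
  define \<nu> where "\<nu> = ?l - \<mu>"
  have Re\<nu>: "Re \<nu> > 0" using \<mu>(2) by (simp add: \<nu>_def)
  then have "\<nu> \<noteq> 0" by auto
  have yy: "bil ?y ?y = 1" using y(1) by (simp add: bil_cvec_cvec dot_square_norm)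
  have Cy: "cmat J *v ?y = ?l *s ?y"
    using y(2) by (simp add: cmat_mult_cvec) (simp add: vec_eq_iff)
  obtain x where x: "x \<noteq> 0" "cmat J *v x = \<mu> *s x"
    using \<mu>(1) by (auto simp: eigvals_def)
  define v where "v = x - bil ?y x *s ?y"
  have "v \<noteq> 0"
  proof
    assume "v = 0"
    define e where "e = bil ?y x"
    have xe: "x = e *s ?y" using \<open>v = 0\<close> by (simp add: v_def e_def)
    have "cmat J *v x = ?l *s x"
      unfolding xe by (simp add: vec.scale Cy mult.commute)
    then have "\<nu> *s x = 0" using x(2) by (metis \<nu>_def vec.scale_left_diff_distrib diff_self)
    then show False using \<open>\<nu> \<noteq> 0\<close> x(1) by simp
  qed
  have Bv: "cmat ?B *v v = \<nu> *s v"
  proof -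
    have "cmat ?B *v ?y = 0"
      by (simp add: cmat_lin_field_mult Cy bil_scale_right yy)
    then have "cmat ?B *v v = cmat ?B *v x" by (simp add: v_def vec.diff vec.scale)
    also have "\<dots> = \<nu> *s v"
      by (simp add: cmat_lin_field_mult x(2) bil_scale_right v_def \<nu>_def vec_eq_iff algebra_simps)
    finally show ?thesis .
  qed
  have "bil ?y v = 0"
    using bil_cvec_cmat_lin_field[OF y(1), of J l 0 v] Bv \<open>\<nu> \<noteq> 0\<close> by (simp add: bil_scale_right)
  \<comment> \<open>The spectrum is finite, so some \<gamma> in this interval avoids all real parts.
    The value 0 is no choice, because \<open>?B\<close> annihilates \<open>y\<close>.\<close>
  have "infinite {0<..<Re \<nu>}" using Re\<nu> by (simp add: infinite_Ioo)
  then obtain \<gamma> where \<gamma>: "0 < \<gamma>" "\<gamma> < Re \<nu>" "\<gamma> \<notin> Re ` eigvals ?B"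
    using finite_imageI[OF finite_eigvals[of ?B], of Re]
    by (metis finite_subset greaterThanLessThan_iff subsetI)
  from \<gamma>(3) have spec: "Re \<mu> \<noteq> \<gamma>" if "\<mu> \<in> eigvals ?B" for \<mu> using that by auto
  obtain \<beta> \<kappa> where \<beta>: "bounded_bilinear \<beta>" "\<And>x y. \<beta> x y = \<beta> y x" "\<kappa> > 0"
    "\<And>x. \<beta> x (?B *v x) \<ge> \<gamma> * \<beta> x x + \<kappa> * (norm x)\<^sup>2"
    by (rule lyapunov_form[of ?B \<gamma>]) (rule spec, assumption, rule that)
  interpret \<beta>: bounded_bilinear \<beta> by fact
  define a where "a = (\<chi> i. Re (v $ i))"
  define b where "b = (\<chi> i. Im (v $ i))"
  \<comment> \<open>The real and imaginary parts are mixed by \<open>?B\<close>, but the terms with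
    \<open>Im \<nu>\<close> cancel by symmetry of \<beta>.\<close>
  have "\<beta> a (?B *v a) + \<beta> b (?B *v b) = Re \<nu> * (\<beta> a a + \<beta> b b)"
    using \<beta>(2)[of a b]
    unfolding eigenvector_Re_Im[OF Bv, folded a_def b_def]
    by (simp add: \<beta>.add_right \<beta>.diff_right \<beta>.scaleR_right algebra_simps)
  moreover have "(norm a)\<^sup>2 + (norm b)\<^sup>2 > 0"
  proof -
    have "a \<noteq> 0 \<or> b \<noteq> 0"
      using \<open>v \<noteq> 0\<close> by (auto simp: a_def b_def vec_eq_iff complex_eq_iff)
    then show ?thesis by (auto simp: add_pos_nonneg add_nonneg_pos)
  qed
  then have "\<kappa> * ((norm a)\<^sup>2 + (norm b)\<^sup>2) > 0" using \<beta>(3) by simp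
  ultimately have "(Re \<nu> - \<gamma>) * (\<beta> a a + \<beta> b b) > 0"
    using \<beta>(4)[of a] \<beta>(4)[of b] by (simp add: algebra_simps)
  then have "\<beta> a a + \<beta> b b > 0" using \<gamma>(2) by (simp add: zero_less_mult_iff)
  then consider "\<beta> a a > 0" | "\<beta> b b > 0" by linarith
  moreover have "y \<bullet> a = Re (bil ?y v)" "y \<bullet> b = Im (bil ?y v)"
    by (simp_all add: bil_def inner_vec_def a_def b_def)
  then have ab: "y \<bullet> a = 0" "y \<bullet> b = 0" using \<open>bil ?y v = 0\<close> by simp_all
  ultimately show ?thesis
  proof cases
    case 1
    show ?thesis by (rule that[OF \<beta>(1-3) \<gamma>(1) \<beta>(4) ab(1) 1])
  next
    case 2
    show ?thesis by (rule that[OF \<beta>(1-3) \<gamma>(1) \<beta>(4) ab(2) 2])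
  qed
qed

subsection \<open>Global solutions, Lyapunov and Chetaev functions\<close>

lemma at_within_atLeast: "a < t \<Longrightarrow> at t within {a..} = at (t::real)"
  by (rule at_within_interior) (simp add: interior_real_atLeast)

text \<open>Picard iteration, with increments measured against the weight
  \<open>exp (2 * K * t)\<close>. In this weight each iteration gains a factor 1/2, so the iterates
  converge uniformly on every \<open>{0..T}\<close> and no local solutions have to be
  continued.\<close>

lemma lipschitz_ode_global_solution:
  fixes f :: "'a::euclidean_space \<Rightarrow> 'a"
  assumes lip: "L-lipschitz_on UNIV f"
  obtains y where "y 0 = y0"
    "\<And>t. t \<ge> 0 \<Longrightarrow> (y has_vector_derivative f (y t)) (at t within {0..})"
proof -
  \<comment> \<open>The maximum with 1 permits division by \<open>2 * K\<close> and gives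
    \<open>t \<le> exp (2 * K * t)\<close> for the first increment.\<close>
  define K where "K = max L 1"
  have K: "K \<ge> 1" by (simp add: K_def)
  have fK: "norm (f x - f y) \<le> K * norm (x - y)" for x y
  proof -
    have "norm (f x - f y) \<le> L * norm (x - y)"
      using lipschitz_onD[OF lip, of x y] by (simp add: dist_norm)
    also have "\<dots> \<le> K * norm (x - y)"
      by (intro mult_right_mono) (auto simp: K_def)
    finally show ?thesis .
  qed
  have contf: "continuous_on UNIV f"
    using lip by (rule lipschitz_on_continuous_on)
  define X where "X = rec_nat (\<lambda>t::real. y0) (\<lambda>_ g t. y0 + integral {0..t} (\<lambda>s. f (g s)))"
  have X0: "X 0 t = y0" and XS: "X (Suc k) t = y0 + integral {0..t} (\<lambda>s. f (X k s))" for k t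
    by (simp_all add: X_def)
  have contX: "continuous_on {0..T} (X k)" for k T
  proof (induction k)
    case 0
    then show ?case by (simp add: X_def)
  next
    case (Suc k)
    have "continuous_on {0..T} (\<lambda>s. f (X k s))"
      using Suc by (intro continuous_on_compose2[OF contf]) auto
    then have "continuous_on {0..T} (\<lambda>t. y0 + integral {0..t} (\<lambda>s. f (X k s)))"
      by (intro continuous_intros indefinite_integral_continuous_1 integrable_continuous_real)
    then show ?case by (simp add: X_def)
  qed
  have contfX: "continuous_on {0..T} (\<lambda>s. f (X k s))" for k T
    by (intro continuous_on_compose2[OF contf contX]) auto
  define M where "M = norm (f y0)"
  have exp_int: "((\<lambda>s. exp (2 * K * s)) has_integral (exp (2 * K * t) / (2 * K) - 1 / (2 * K))) {0..t}"
    if "t \<ge> 0" for t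
  proof -
    have "((\<lambda>s. exp (2 * K * s) / (2 * K)) has_vector_derivative exp (2 * K * s)) (at s within {0..t})" for s
      using K unfolding has_real_derivative_iff_has_vector_derivative[symmetric]
      by (auto intro!: derivative_eq_intros)
    from fundamental_theorem_of_calculus[OF \<open>t \<ge> 0\<close> this] show ?thesis by simp
  qed
  have step: "norm (X (Suc k) t - X k t) \<le> M * (1 / 2) ^ k * exp (2 * K * t)" if "t \<ge> 0" for k t
    using that
  proof (induction k arbitrary: t)
    case 0
    have "t \<le> exp (2 * K * t)"
    proof -
      have "t \<le> 1 + 2 * K * t" using K 0 by (simp add: add_increasing mult_le_cancel_right1)
      also have "\<dots> \<le> exp (2 * K * t)" by (rule exp_ge_add_one_self)
      finally show ?thesis .
    qed
    then have "t * M \<le> exp (2 * K * t) * M"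
      by (intro mult_right_mono) (simp_all add: M_def)
    then show ?case using 0 by (simp add: X_def M_def mult_ac)
  next
    case (Suc k)
    have "X (Suc (Suc k)) t - X (Suc k) t
        = integral {0..t} (\<lambda>s. f (X (Suc k) s)) - integral {0..t} (\<lambda>s. f (X k s))"
      by (simp only: XS) simp
    also have "\<dots> = integral {0..t} (\<lambda>s. f (X (Suc k) s) - f (X k s))"
      by (intro Henstock_Kurzweil_Integration.integral_diff[symmetric]
          integrable_continuous_real contfX)
    finally have eq: "X (Suc (Suc k)) t - X (Suc k) t
        = integral {0..t} (\<lambda>s. f (X (Suc k) s) - f (X k s))" .
    let ?c = "K * M * (1 / 2) ^ k"
    have "norm (X (Suc (Suc k)) t - X (Suc k) t) \<le> integral {0..t} (\<lambda>s. ?c * exp (2 * K * s))"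
      unfolding eq
    proof (rule integral_norm_bound_integral)
      show "(\<lambda>s. f (X (Suc k) s) - f (X k s)) integrable_on {0..t}"
        by (intro integrable_continuous_real continuous_intros contfX)
      show "(\<lambda>s. ?c * exp (2 * K * s)) integrable_on {0..t}"
        by (intro integrable_continuous_real continuous_intros)
      show "norm (f (X (Suc k) s) - f (X k s)) \<le> ?c * exp (2 * K * s)" if "s \<in> {0..t}" for s
      proof -
        have "norm (f (X (Suc k) s) - f (X k s)) \<le> K * norm (X (Suc k) s - X k s)"
          by (rule fK)
        also have "\<dots> \<le> K * (M * (1 / 2) ^ k * exp (2 * K * s))"
          using Suc.IH[of s] that K by (intro mult_left_mono) auto
        finally show ?thesis by (simp add: mult_ac)
      qed
    qed
    also have "\<dots> = ?c * (exp (2 * K * t) / (2 * K) - 1 / (2 * K))"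
      using has_integral_mult_right[OF exp_int[OF Suc.prems]] by (rule integral_unique)
    also have "\<dots> \<le> ?c * (exp (2 * K * t) / (2 * K))"
      using K by (intro mult_left_mono) (auto simp: M_def)
    also have "\<dots> = M * (1 / 2) ^ Suc k * exp (2 * K * t)"
      using K by (simp add: field_simps)
    finally show ?case .
  qed
  \<comment> \<open>The limit of the iterates, written as a telescoping series to fit the
    Weierstrass test.\<close>
  define Y where "Y t = y0 + (\<Sum>k. X (Suc k) t - X k t)" for t
  have lim: "uniform_limit {0..T} X Y sequentially" for T
  proof -
    have "uniform_limit {0..T} (\<lambda>n t. \<Sum>k<n. X (Suc k) t - X k t)
        (\<lambda>t. \<Sum>k. X (Suc k) t - X k t) sequentially"
    proof (rule Weierstrass_m_test)
      show "norm (X (Suc k) t - X k t) \<le> M * exp (2 * K * T) * (1 / 2) ^ k" if "t \<in> {0..T}" for k t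
      proof -
        have "exp (2 * K * t) \<le> exp (2 * K * T)" using that K by simp
        then have "M * (1 / 2) ^ k * exp (2 * K * t) \<le> M * (1 / 2) ^ k * exp (2 * K * T)"
          by (intro mult_left_mono) (auto simp: M_def)
        then show ?thesis using step[of t k] that by (simp add: mult_ac)
      qed
      show "summable (\<lambda>k. M * exp (2 * K * T) * (1 / 2) ^ k)"
        by (intro summable_mult summable_geometric) simp
    qed
    then have "uniform_limit {0..T} (\<lambda>n t. y0 + (\<Sum>k<n. X (Suc k) t - X k t)) Y sequentially"
      unfolding Y_def by (intro uniform_limit_intros)
    moreover have "y0 + (\<Sum>k<n. X (Suc k) t - X k t) = X n t" for n t
      using sum_lessThan_telescope[of "\<lambda>k. X k t" n] by (simp add: X0)
    ultimately show ?thesis by simp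
  qed
  have contY: "continuous_on {0..T} Y" for T
    using lim contX by (intro uniform_limit_theorem[OF _ lim]) auto
  have contfY: "continuous_on {0..T} (\<lambda>s. f (Y s))" for T
    by (intro continuous_on_compose2[OF contf contY]) auto
  have Yeq: "Y t = y0 + integral {0..t} (\<lambda>s. f (Y s))" if "t \<ge> 0" for t
  proof -
    \<comment> \<open>Uniform continuity carries the uniform convergence over to \<open>f\<close>,
      so the limit may be taken under the integral.\<close>
    have "uniformly_continuous_on UNIV f"
      using lip by (rule lipschitz_on_uniformly_continuous)
    then have ul: "uniform_limit {0..t} (\<lambda>n s. f (X n s)) (\<lambda>s. f (Y s)) sequentially"
      by (rule uniform_limit_compose_uniformly_continuous_on[OF lim _ _ closed_UNIV]) simp
    obtain I J where IJ: "\<And>n. ((\<lambda>s. f (X n s)) has_integral I n) {0..t}"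
        "((\<lambda>s. f (Y s)) has_integral J) {0..t}" "I \<longlonglongrightarrow> J"
      using uniform_limit_integral[OF ul contfX trivial_limit_sequentially] by metis
    have I: "X (Suc n) t = y0 + I n" for n
      using IJ(1)[of n] by (simp add: XS integral_unique)
    have J: "J = integral {0..t} (\<lambda>s. f (Y s))"
      using IJ(2) by (simp add: integral_unique)
    have "(\<lambda>n. X (Suc n) t) \<longlonglongrightarrow> y0 + J"
      unfolding I using IJ(3) by (intro tendsto_intros)
    moreover have "(\<lambda>n. X n t) \<longlonglongrightarrow> Y t"
      using lim[of t] that by (intro tendsto_uniform_limitI) auto
    then have "(\<lambda>n. X (Suc n) t) \<longlonglongrightarrow> Y t"
      by (rule LIMSEQ_Suc)
    ultimately show ?thesis
      using LIMSEQ_unique J by blast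
  qed
  show ?thesis
  proof (rule that[of Y])
    show "Y 0 = y0" using Yeq[of 0] by simp
    show "(Y has_vector_derivative f (Y t)) (at t within {0..})" if "t \<ge> 0" for t
    proof -
      have "((\<lambda>u. y0 + integral {0..u} (\<lambda>s. f (Y s))) has_vector_derivative f (Y t)) (at t within {0..t+1})"
        using integral_has_vector_derivative[OF contfY, of t "t+1"] that
        by (auto intro!: derivative_eq_intros)
      then have "(Y has_vector_derivative f (Y t)) (at t within {0..t+1})"
        by (rule has_vector_derivative_transform[rotated 2]) (use that Yeq in auto)
      \<comment> \<open>The end point \<open>t + 1\<close> leaves room to the right of
        \<open>t\<close>, so the filter is that of the half-line.\<close>
      moreover have "at t within {0..t+1} = at t within {0..}"
        by (rule at_within_nhd[of _ "{..<t+1}"]) auto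
      ultimately show ?thesis by simp
    qed
  qed
qed

section \<open>Quadratic Lyapunov and Chetaev functions along curves\<close>

lemma has_vector_derivative_continuous_on_ray:
  assumes "\<And>t. 0 \<le> t \<Longrightarrow> (u has_vector_derivative u' t) (at t within {0..})"
  shows "continuous_on {0..} u"
  unfolding continuous_on_eq_continuous_within
  using has_vector_derivative_continuous[OF assms] by auto

lemma increasing_on_ray:
  fixes u :: "real \<Rightarrow> real"
  assumes "0 \<le> a" "a \<le> b"
    and "\<And>t. 0 \<le> t \<Longrightarrow> (u has_vector_derivative u' t) (at t within {0..})"
    and "\<And>t. a < t \<Longrightarrow> t < b \<Longrightarrow> u' t \<ge> 0"
  shows "u a \<le> u b"
proof (rule DERIV_nonneg_imp_increasing_open[OF assms(2)])
  fix t assume "a < t" "t < b"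
  then show "\<exists>y. (u has_real_derivative y) (at t) \<and> 0 \<le> y"
    using assms(1,4) assms(3)[of t] at_within_atLeast[of 0 t]
    by (auto simp: has_real_derivative_iff_has_vector_derivative)
next
  have "continuous_on {0..} u"
    using assms(3) by (rule has_vector_derivative_continuous_on_ray)
  then show "continuous_on {a..b} u"
    by (rule continuous_on_subset) (use assms(1) in auto)
qed

lemma bounded_bilinear_diagonal_derivative:
  fixes \<beta> :: "'a::real_normed_vector \<Rightarrow> 'a \<Rightarrow> real"
  assumes "bounded_bilinear \<beta>" "\<And>x y. \<beta> x y = \<beta> y x"
    and "(h has_vector_derivative h') (at t within T)"
  shows "((\<lambda>t. \<beta> (h t) (h t)) has_vector_derivative 2 * \<beta> (h t) h') (at t within T)"
  using bounded_bilinear.has_vector_derivative[OF assms(1,3,3)] assms(2)[of h' "h t"] by simp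

text \<open>\<open>- \<beta> x x\<close> is comparable with the squared norm and does not increase
  while the curve is within \<open>r\<close>. \<delta> is chosen before the curve, and
  \<open>h'\<close> is tied to no vector field, so a sign condition known only on the sphere can be
  used.\<close>

lemma lyapunov_stability:
  fixes \<beta> :: "'a::euclidean_space \<Rightarrow> 'a \<Rightarrow> real"
  assumes \<beta>: "bounded_bilinear \<beta>" "\<And>x y. \<beta> x y = \<beta> y x" "\<And>x. x \<noteq> 0 \<Longrightarrow> \<beta> x x < 0"
    and "r > 0" "\<epsilon> > 0"
  shows "\<exists>\<delta>>0. \<forall>h h'. norm (h 0) < \<delta>
      \<and> (\<forall>t\<ge>0. (h has_vector_derivative h' t) (at t within {0..}))
      \<and> (\<forall>t\<ge>0. norm (h t) < r \<longrightarrow> \<beta> (h t) (h' t) \<ge> 0) \<longrightarrow> (\<forall>t\<ge>0. norm (h t) < \<epsilon>)"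
proof -
  interpret \<beta>: bounded_bilinear \<beta> by fact
  have "continuous_on (sphere 0 1) (\<lambda>x. \<beta> x x)"
    by (intro \<beta>.continuous_on continuous_intros)
  then obtain x0 where x0: "x0 \<in> sphere 0 1" "\<And>x. x \<in> sphere 0 1 \<Longrightarrow> \<beta> x x \<le> \<beta> x0 x0"
    using continuous_attains_sup[of "sphere (0::'a) 1" "\<lambda>x. \<beta> x x"] by auto
  define m where "m = - \<beta> x0 x0"
  have m: "m > 0" using \<beta>(3)[of x0] x0(1) by (cases "x0 = 0") (auto simp: m_def)
  have lower: "m * (norm x)\<^sup>2 \<le> - \<beta> x x" for x
  proof (cases "x = 0")
    case True
    then show ?thesis by (simp add: \<beta>.zero_left)
  next
    case False
    define z where "z = x /\<^sub>R norm x"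
    have "\<beta> x x = (norm x)\<^sup>2 * \<beta> z z"
      using False by (simp add: z_def \<beta>.scaleR_left \<beta>.scaleR_right power2_eq_square field_simps)
    moreover have "\<beta> z z \<le> - m"
      using x0(2)[of z] False by (simp add: z_def m_def)
    then have "(norm x)\<^sup>2 * \<beta> z z \<le> (norm x)\<^sup>2 * (- m)"
      by (intro mult_left_mono) auto
    ultimately show ?thesis by (simp add: mult.commute)
  qed
  obtain K where K: "K > 0" "\<And>x y. \<bar>\<beta> x y\<bar> \<le> norm x * norm y * K"
    using \<beta>.pos_bounded by auto
  \<comment> \<open>Below \<open>e\<close> the curve is both in the target ball and where the sign
    of the derivative is known.\<close>
  define e where "e = min \<epsilon> r"
  have e: "e > 0" using assms(4,5) by (simp add: e_def)
  \<comment> \<open>Ensures \<open>K * \<delta>\<^sup>2 \<le> m * e\<^sup>2\<close>, so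
    \<open>- \<beta>\<close> starts below its lower bound on norms of at least
    \<open>e\<close>.\<close>
  define \<delta> where "\<delta> = min e (sqrt (m / K) * e)"
  show ?thesis
  proof (intro exI[of _ \<delta>] conjI allI impI)
    show "\<delta> > 0" using e m K(1) by (simp add: \<delta>_def)
    fix h h' and t :: real
    assume *: "norm (h 0) < \<delta>
      \<and> (\<forall>t\<ge>0. (h has_vector_derivative h' t) (at t within {0..}))
      \<and> (\<forall>t\<ge>0. norm (h t) < r \<longrightarrow> \<beta> (h t) (h' t) \<ge> 0)" and t: "t \<ge> 0"
    then have h0: "norm (h 0) < \<delta>"
      and h: "\<And>t. t \<ge> 0 \<Longrightarrow> (h has_vector_derivative h' t) (at t within {0..})"
      and dec: "\<And>t. t \<ge> 0 \<Longrightarrow> norm (h t) < r \<Longrightarrow> \<beta> (h t) (h' t) \<ge> 0"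
      by blast+
    have "norm (h t) < e"
    proof (rule ccontr)
      assume ge: "\<not> norm (h t) < e"
      have "continuous_on {0..} h"
        using h by (rule has_vector_derivative_continuous_on_ray)
      then have cont: "continuous_on {0..t} (\<lambda>s. norm (h s))"
        by (intro continuous_on_norm) (rule continuous_on_subset, auto)
      define E where "E = {0..t} \<inter> (\<lambda>s. norm (h s)) -` {e..}"
      have "closed E" unfolding E_def
        by (rule continuous_closed_preimage[OF cont]) auto
      moreover have "t \<in> E" using ge t by (simp add: E_def)
      moreover have bdd: "bdd_below E" by (auto simp: E_def intro!: bdd_belowI[of _ 0])
      ultimately have "Inf E \<in> E"
        by (intro closed_contains_Inf) auto
      \<comment> \<open>The first time the norm reaches \<open>e\<close>, attained because
        \<open>E\<close> is closed.\<close>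
      define s where "s = Inf E"
      have s: "0 \<le> s" "norm (h s) \<ge> e" "s \<le> t" using \<open>Inf E \<in> E\<close> by (auto simp: s_def E_def)
      have before: "norm (h q) < e" if "0 \<le> q" "q < s" for q
      proof (rule ccontr)
        assume "\<not> norm (h q) < e"
        then have "q \<in> E" using that s by (auto simp: E_def)
        then show False using cInf_lower[OF _ bdd, of q] that by (simp add: s_def)
      qed
      have "\<beta> (h 0) (h 0) \<le> \<beta> (h s) (h s)"
      proof (rule increasing_on_ray[where u = "\<lambda>t. \<beta> (h t) (h t)"])
        show "((\<lambda>t. \<beta> (h t) (h t)) has_vector_derivative 2 * \<beta> (h t) (h' t)) (at t within {0..})"
          if "0 \<le> t" for t
          using \<beta>(1,2) h[OF that] by (rule bounded_bilinear_diagonal_derivative)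
        show "2 * \<beta> (h q) (h' q) \<ge> 0" if "0 < q" "q < s" for q
          using dec[of q] before[of q] that by (auto simp: e_def)
      qed (use s in auto)
      moreover have "m * e\<^sup>2 \<le> - \<beta> (h s) (h s)"
      proof -
        have "m * e\<^sup>2 \<le> m * (norm (h s))\<^sup>2"
          using s(2) e m by (intro mult_left_mono power_mono) auto
        then show ?thesis using lower[of "h s"] by simp
      qed
      moreover have "- \<beta> (h 0) (h 0) < m * e\<^sup>2"
      proof -
        have "- \<beta> (h 0) (h 0) \<le> K * (norm (h 0))\<^sup>2"
          using K(2)[of "h 0" "h 0"] by (simp add: power2_eq_square mult_ac)
        also have "\<dots> < K * (sqrt (m / K) * e)\<^sup>2"
          using h0 K(1) by (intro mult_strict_left_mono power_strict_mono) (auto simp: \<delta>_def)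
        also have "\<dots> = m * e\<^sup>2"
          using m K(1) by (simp add: power_mult_distrib)
        finally show ?thesis .
      qed
      ultimately show False by linarith
    qed
    then show "norm (h t) < \<epsilon>" by (simp add: e_def)
  qed
qed

text \<open>\<open>exp (- 2 * \<gamma> * t) * \<beta> (h t) (h t)\<close> is nondecreasing, so the
  form grows exponentially, which a bounded curve does not allow.\<close>

lemma chetaev_instability:
  fixes \<beta> :: "'a::real_normed_vector \<Rightarrow> 'a \<Rightarrow> real"
  assumes \<beta>: "bounded_bilinear \<beta>" "\<And>x y. \<beta> x y = \<beta> y x"
    and h: "\<And>t. t \<ge> 0 \<Longrightarrow> (h has_vector_derivative h' t) (at t within {0..})"
    and grow: "\<And>t. t \<ge> 0 \<Longrightarrow> \<beta> (h t) (h' t) \<ge> \<gamma> * \<beta> (h t) (h t)"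
    and "\<gamma> > 0" "\<beta> (h 0) (h 0) > 0"
    and bdd: "\<And>t. t \<ge> 0 \<Longrightarrow> norm (h t) \<le> R"
  shows False
proof -
  interpret \<beta>: bounded_bilinear \<beta> by fact
  let ?u = "\<lambda>t. \<beta> (h t) (h t)"
  have mono: "exp (- 2 * \<gamma> * 0) * ?u 0 \<le> exp (- 2 * \<gamma> * t) * ?u t" if "t \<ge> 0" for t
  proof (rule increasing_on_ray[where u = "\<lambda>t. exp (- 2 * \<gamma> * t) * ?u t"])
    fix q :: real assume q: "0 \<le> q"
    have "((\<lambda>t. exp (- 2 * \<gamma> * t)) has_vector_derivative (- 2 * \<gamma>) * exp (- 2 * \<gamma> * q)) (at q within {0..})"
      unfolding has_real_derivative_iff_has_vector_derivative[symmetric]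
      by (auto intro!: derivative_eq_intros)
    moreover have "(?u has_vector_derivative 2 * \<beta> (h q) (h' q)) (at q within {0..})"
      using \<beta> h[OF q] by (rule bounded_bilinear_diagonal_derivative)
    ultimately show "((\<lambda>t. exp (- 2 * \<gamma> * t) * ?u t) has_vector_derivative
        exp (- 2 * \<gamma> * q) * (2 * \<beta> (h q) (h' q)) + (- 2 * \<gamma>) * exp (- 2 * \<gamma> * q) * ?u q)
        (at q within {0..})"
      by (rule has_vector_derivative_mult)
  next
    fix q :: real assume "0 < q" "q < t"
    then have "exp (- 2 * \<gamma> * q) * (\<gamma> * ?u q) \<le> exp (- 2 * \<gamma> * q) * \<beta> (h q) (h' q)"
      using grow[of q] by (intro mult_left_mono) auto
    then show "0 \<le> exp (- 2 * \<gamma> * q) * (2 * \<beta> (h q) (h' q)) + (- 2 * \<gamma>) * exp (- 2 * \<gamma> * q) * ?u q"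
      by (simp add: mult_ac)
  qed (use that in auto)
  obtain K where K: "K > 0" "\<And>x y. \<bar>\<beta> x y\<bar> \<le> norm x * norm y * K"
    using \<beta>.pos_bounded by auto
  have up: "?u t \<le> K * R\<^sup>2" if "t \<ge> 0" for t
  proof -
    have "?u t \<le> K * (norm (h t))\<^sup>2"
      using K(2)[of "h t" "h t"] by (simp add: power2_eq_square mult_ac)
    also have "\<dots> \<le> K * R\<^sup>2"
      using K(1) bdd[OF that] by (intro mult_left_mono power_mono) auto
    finally show ?thesis .
  qed
  \<comment> \<open>By \<open>exp x \<ge> 1 + x\<close>, at this time the linear term alone
    contributes \<open>K * R\<^sup>2\<close>, and the positive initial value exceeds the
    bound.\<close>
  define t where "t = K * R\<^sup>2 / (2 * \<gamma> * ?u 0)"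
  have t: "t \<ge> 0" using K(1) assms(5,6) by (simp add: t_def)
  have "?u 0 * exp (2 * \<gamma> * t) \<le> exp (2 * \<gamma> * t) * (exp (- 2 * \<gamma> * t) * ?u t)"
    using mult_left_mono[OF mono[OF t], of "exp (2 * \<gamma> * t)"] by (simp add: mult_ac)
  also have "\<dots> = ?u t"
    by (simp add: mult.assoc[symmetric] exp_add[symmetric])
  also have "\<dots> \<le> K * R\<^sup>2" by (rule up[OF t])
  finally have "?u 0 * exp (2 * \<gamma> * t) \<le> K * R\<^sup>2" .
  moreover have "?u 0 * (1 + 2 * \<gamma> * t) \<le> ?u 0 * exp (2 * \<gamma> * t)"
    using assms(6) by (intro mult_left_mono exp_ge_add_one_self) auto
  moreover have "?u 0 * (1 + 2 * \<gamma> * t) = ?u 0 + K * R\<^sup>2"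
    using assms(5,6) by (simp add: t_def field_simps)
  ultimately show False using assms(6) by linarith
qed

subsection \<open>The eigenvector flow\<close>

text \<open>Compare directions and lengths separately. The factor 2 comes from
  \<open>norm y * norm (u x - u y) \<le> 2 * norm (x - y)\<close>, and the difference of lengths
  contributes \<open>M\<close>.\<close>

lemma homogeneous_lipschitz:
  fixes f :: "'a::real_normed_vector \<Rightarrow> 'b::real_normed_vector"
  assumes hom: "\<And>a x. a > 0 \<Longrightarrow> f (a *\<^sub>R x) = a *\<^sub>R f x"
    and M: "\<And>x. norm x = 1 \<Longrightarrow> norm (f x) \<le> M" and "M \<ge> 0"
    and L: "\<And>x y. norm x = 1 \<Longrightarrow> norm y = 1 \<Longrightarrow> norm (f x - f y) \<le> L * norm (x - y)" and "L \<ge> 0"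
  shows "(2 * L + M)-lipschitz_on UNIV f"
proof -
  have f0: "f 0 = 0"
    using hom[of 2 0] by (simp add: scaleR_2)
  define u where "u x = x /\<^sub>R norm x" for x :: 'a
  have u: "norm (u x) = 1" "x = norm x *\<^sub>R u x" if "x \<noteq> 0" for x
    using that by (simp_all add: u_def)
  have fu: "f x = norm x *\<^sub>R f (u x)" if "x \<noteq> 0" for x
    using hom[of "norm x" "u x"] u(2)[OF that] that by simp
  have bound: "norm (f x) \<le> M * norm x" for x
    using fu[of x] M[OF u(1), of x] f0
    by (cases "x = 0") (simp_all add: mult.commute mult_right_mono)
  show ?thesis
  proof (rule lipschitz_onI)
    fix x y :: 'a
    have "norm (f x - f y) \<le> (2 * L + M) * norm (x - y)"
    proof (cases "x = 0 \<or> y = 0")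
      case True
      then have "norm (f x - f y) \<le> M * norm (x - y)"
        using bound[of x] bound[of y] f0 by auto
      also have "\<dots> \<le> (2 * L + M) * norm (x - y)"
        using \<open>L \<ge> 0\<close> by (intro mult_right_mono) auto
      finally show ?thesis .
    next
      case False
      then have x: "x \<noteq> 0" and y: "y \<noteq> 0" by auto
      have diff: "norm y *\<^sub>R (u x - u y) = (norm y - norm x) *\<^sub>R u x + (x - y)"
        using u(2)[OF x] u(2)[OF y] by (simp add: algebra_simps)
      have "norm (norm y *\<^sub>R (u x - u y)) \<le> \<bar>norm y - norm x\<bar> * norm (u x) + norm (x - y)"
        unfolding diff by (rule order_trans[OF norm_triangle_ineq]) simp
      also have "\<dots> \<le> 2 * norm (x - y)"
        using norm_triangle_ineq3[of x y] u(1)[OF x] by simp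
      finally have uu: "norm y * norm (u x - u y) \<le> 2 * norm (x - y)" by simp
      have "f x - f y = norm y *\<^sub>R (f (u x) - f (u y)) + (norm x - norm y) *\<^sub>R f (u x)"
        unfolding fu[OF x] fu[OF y] by (simp add: algebra_simps)
      then have "norm (f x - f y) \<le> norm y * norm (f (u x) - f (u y)) + \<bar>norm x - norm y\<bar> * norm (f (u x))"
        using norm_triangle_ineq[of "norm y *\<^sub>R (f (u x) - f (u y))" "(norm x - norm y) *\<^sub>R f (u x)"]
        by simp
      also have "\<dots> \<le> norm y * (L * norm (u x - u y)) + norm (x - y) * M"
        using L[OF u(1)[OF x] u(1)[OF y]] M[OF u(1)[OF x]] norm_triangle_ineq3[of x y]
        by (intro add_mono mult_mono mult_left_mono) auto
      also have "norm y * (L * norm (u x - u y)) \<le> L * (2 * norm (x - y))"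
        using mult_left_mono[OF uu \<open>L \<ge> 0\<close>] by (simp add: mult_ac)
      finally show ?thesis by (simp add: algebra_simps)
    qed
    then show "dist (f x) (f y) \<le> (2 * L + M) * dist x y" by (simp add: dist_norm)
  qed (use \<open>L \<ge> 0\<close> \<open>M \<ge> 0\<close> in simp)
qed

lemma bounded_bilinear_matrix_vector_mult:
  "bounded_bilinear (\<lambda>(M :: real^'n^'m) x. M *v x)"
  unfolding bilinear_conv_bounded_bilinear[symmetric] bilinear_def
  by (auto intro!: linearI simp: matrix_vector_mult_add_rdistrib scaleR_matrix_vector_assoc
      matrix_vector_right_distrib matrix_vector_mult_scaleR)

text \<open>The sphere is not convex, so the mean value inequality is applied only along chords of
  length at most 1, which avoid the origin; for points further apart the bound on \<open>f\<close>
  suffices.\<close>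

lemma C1_lipschitz_on_sphere:
  fixes f :: "'a::euclidean_space \<Rightarrow> 'b::real_normed_vector"
  assumes D: "\<And>x. x \<noteq> 0 \<Longrightarrow> (f has_derivative blinfun_apply (D x)) (at x)"
    and cont: "continuous_on (- {0}) D"
  obtains L K where "L \<ge> 0" "K > 0" "\<And>x. norm x = 1 \<Longrightarrow> norm (f x) \<le> K"
    "\<And>x y. norm x = 1 \<Longrightarrow> norm y = 1 \<Longrightarrow> norm (f x - f y) \<le> L * norm (x - y)"
proof -
  have "isCont f x" if "x \<in> sphere 0 1" for x
  proof (rule has_derivative_continuous[OF D])
    show "x \<noteq> 0" using that by auto
  qed
  then have "continuous_on (sphere 0 1) f"
    by (intro continuous_at_imp_continuous_on) auto
  then have "bounded (f ` sphere 0 1)"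
    by (intro compact_imp_bounded compact_continuous_image) auto
  then obtain K0 where K0: "K0 > 0" "\<And>x. norm x = 1 \<Longrightarrow> norm (f x) \<le> K0"
    by (auto simp: bounded_pos)
  define R where "R = cball 0 1 - ball (0::'a) (1/2)"
  have "compact R" unfolding R_def by (intro compact_diff) auto
  moreover have "continuous_on R D"
    by (rule continuous_on_subset[OF cont]) (auto simp: R_def)
  ultimately have "bounded (D ` R)"
    by (intro compact_imp_bounded compact_continuous_image)
  then obtain K1 where K1: "K1 > 0" "\<And>x. x \<in> R \<Longrightarrow> norm (D x) \<le> K1"
    by (auto simp: bounded_pos)
  have "norm (f x - f y) \<le> max K1 (2 * K0) * norm (x - y)" if xy: "norm x = 1" "norm y = 1" for x y
  proof (cases "norm (x - y) \<le> 1")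
    case True
    have seg: "closed_segment x y \<subseteq> R"
    proof
      fix z assume z: "z \<in> closed_segment x y"
      have "norm z \<le> 1"
        using z xy convex_cball[of "0::'a" 1] closed_segment_subset[of x "cball 0 1" y] by auto
      \<comment> \<open>The distances of \<open>z\<close> to the end points add up to at most 1, so
        one is at most 1/2.\<close>
      moreover have "norm z \<ge> 1 / 2"
      proof -
        have "norm (z - x) + norm (z - y) = norm (x - y)"
          using z between_mem_segment[of x y z] between[of x y z] by (simp add: dist_norm norm_minus_commute)
        moreover have "1 \<le> norm z + norm (z - x)" "1 \<le> norm z + norm (z - y)"
          using norm_triangle_sub[of x z] norm_triangle_sub[of y z] xy by (simp_all add: norm_minus_commute)
        ultimately show ?thesis using True by linarith
      qed
      ultimately show "z \<in> R" by (simp add: R_def)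
    qed
    have "norm (f x - f y) \<le> K1 * norm (x - y)"
    proof (rule differentiable_bound[of "closed_segment x y"])
      fix z assume "z \<in> closed_segment x y"
      then have z: "z \<in> R" using seg by blast
      then have "z \<noteq> 0" by (auto simp: R_def)
      then show "(f has_derivative blinfun_apply (D z)) (at z within closed_segment x y)"
        using D has_derivative_at_withinI by blast
      show "onorm (blinfun_apply (D z)) \<le> K1"
        using K1(2)[OF z] by (simp add: norm_blinfun.rep_eq)
    qed auto
    also have "\<dots> \<le> max K1 (2 * K0) * norm (x - y)"
      by (intro mult_right_mono) auto
    finally show ?thesis .
  next
    case False
    have "norm (f x - f y) \<le> 2 * K0"
      using norm_triangle_ineq4[of "f x" "f y"] K0(2)[of x] K0(2)[of y] xy by linarith
    also have "\<dots> \<le> max K1 (2 * K0) * 1" by simp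
    also have "\<dots> \<le> max K1 (2 * K0) * norm (x - y)"
      using False K0(1) by (intro mult_left_mono) auto
    finally show ?thesis .
  qed
  moreover have "max K1 (2 * K0) \<ge> 0" using K1(1) by simp
  ultimately show ?thesis using that K0 by blast
qed

section \<open>Invariance of the sphere and stationary points\<close>

lemma inner_odef: "y \<bullet> odef A y = 0"
  by (cases "y = 0") (simp_all add: odef_def pq_def inner_diff_right)

lemma odef_sphere_invariant:
  assumes "is_interval I" "0 \<in> I" "is_sol A I y" "norm (y 0) = 1" "t \<in> I"
  shows "norm (y t) = 1"
proof -
  obtain c where "\<And>s. s \<in> I \<Longrightarrow> y s \<bullet> y s = c"
  proof (rule has_vector_derivative_zero_constant)
    show "convex I" using assms(1) by (rule is_interval_convex)
    fix s assume "s \<in> I"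
    then have y': "(y has_vector_derivative odef A (y s)) (at s within I)"
      using assms(3) by (simp add: is_sol_def)
    show "((\<lambda>s. y s \<bullet> y s) has_vector_derivative 0) (at s within I)"
      using bounded_bilinear.has_vector_derivative[OF bounded_bilinear_inner y' y']
      by (simp add: inner_odef inner_commute)
  qed blast
  then have "y t \<bullet> y t = y 0 \<bullet> y 0" using assms(2,5) by metis
  then show ?thesis using assms(4) by (simp add: norm_eq_sqrt_inner)
qed

lemma stationary_iff_eigenvector:
  "stationary A v \<longleftrightarrow> norm v = 1 \<and> (\<exists>c. A v *v v = c *\<^sub>R v)"
proof safe
  assume "stationary A v"
  then show "norm v = 1" "\<exists>c. A v *v v = c *\<^sub>R v"
    by (auto simp: stationary_def odef_def intro!: exI[of _ "pq A v"])
next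
  fix c assume "norm v = 1" "A v *v v = c *\<^sub>R v"
  then show "stationary A v"
    by (simp add: stationary_def odef_def pq_def norm_eq_1)
qed

locale scaling_invariant =
  fixes A :: "real^'n \<Rightarrow> real^'n^'n"
  assumes smooth: "C3_on (UNIV - {0}) A"
    and homog: "\<And>\<alpha> v. \<alpha> \<noteq> 0 \<Longrightarrow> A (\<alpha> *\<^sub>R v) = A v"
begin

lemma derivative_A:
  obtains D where "\<And>x. x \<noteq> 0 \<Longrightarrow> (A has_derivative blinfun_apply (D x)) (at x)" "continuous_on (- {0}) D"
proof -
  from smooth obtain D D2 where D: "\<forall>x\<in>UNIV - {0}. (A has_derivative blinfun_apply (D x)) (at x)"
    and D2: "\<forall>x\<in>UNIV - {0}. (D has_derivative blinfun_apply (D2 x)) (at x)"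
    unfolding C3_on_def by blast
  show ?thesis
  proof (rule that[of D])
    show "(A has_derivative blinfun_apply (D x)) (at x)" if "x \<noteq> 0" for x using D that by simp
    have "isCont D x" if "x \<noteq> 0" for x
      using D2 that by (intro has_derivative_continuous[of D "blinfun_apply (D2 x)"]) auto
    then show "continuous_on (- {0}) D"
      by (intro continuous_at_imp_continuous_on) auto
  qed
qed

lemma odef_scaleR: "a \<noteq> 0 \<Longrightarrow> odef A (a *\<^sub>R x) = a *\<^sub>R odef A x"
  by (simp add: odef_def pq_def homog scaleR_diff_right matrix_vector_mult_scaleR)

lemma odef_lipschitz: "\<exists>L. L-lipschitz_on UNIV (odef A)"
proof -
  obtain D where D: "\<And>x. x \<noteq> 0 \<Longrightarrow> (A has_derivative blinfun_apply (D x)) (at x)" "continuous_on (- {0}) D"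
    using derivative_A by blast
  obtain L K0 where L: "L \<ge> 0"
      "\<And>x y. norm x = 1 \<Longrightarrow> norm y = 1 \<Longrightarrow> norm (A x - A y) \<le> L * norm (x - y)"
    and K0: "K0 > 0" "\<And>x. norm x = 1 \<Longrightarrow> norm (A x) \<le> K0"
    by (rule C1_lipschitz_on_sphere[of A D]) (rule D, assumption, rule D(2), rule that)
  obtain K where K: "K > 0" "\<And>(M :: real^'n^'n) x. norm (M *v x) \<le> norm M * norm x * K"
    using bounded_bilinear.pos_bounded[OF bounded_bilinear_matrix_vector_mult] by blast
  define G where "G x = A x *v x" for x
  define M where "M = K0 * K"
  define L' where "L' = K0 * K + L * K"
  have M: "M \<ge> 0" "L' \<ge> 0" using K0 K L by (simp_all add: M_def L'_def)
  have G: "norm (G x) \<le> M" if "norm x = 1" for x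
  proof -
    have "norm (G x) \<le> norm (A x) * 1 * K" using K(2)[of "A x" x] that by (simp add: G_def)
    also have "\<dots> \<le> M" using K0(2)[OF that] K(1) by (simp add: M_def)
    finally show ?thesis .
  qed
  have GL: "norm (G x - G y) \<le> L' * norm (x - y)" if xy: "norm x = 1" "norm y = 1" for x y
  proof -
    have "G x - G y = A x *v (x - y) + (A x - A y) *v y"
      by (simp add: G_def algebra_simps)
    then have "norm (G x - G y) \<le> norm (A x) * norm (x - y) * K + norm (A x - A y) * norm y * K"
      using K(2)[of "A x" "x - y"] K(2)[of "A x - A y" y]
        norm_triangle_ineq[of "A x *v (x - y)" "(A x - A y) *v y"] by simp
    also have "\<dots> \<le> K0 * norm (x - y) * K + L * norm (x - y) * 1 * K"
      using K0(2) L(2) xy K(1) by (intro add_mono mult_right_mono) auto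
    finally show ?thesis by (simp add: L'_def algebra_simps)
  qed
  \<comment> \<open>On the sphere the Rayleigh quotient loses its denominator, leaving products of
    \<open>x\<close> and \<open>G x\<close>, which are estimated factor by factor.\<close>
  have f: "odef A x = (x \<bullet> G x) *\<^sub>R x - G x" if "norm x = 1" for x
    using that by (simp add: odef_def pq_def G_def norm_eq_1)
  have "norm (odef A x) \<le> 2 * M" if "norm x = 1" for x
  proof -
    have "norm (odef A x) \<le> \<bar>x \<bullet> G x\<bar> * 1 + norm (G x)"
      unfolding f[OF that] using norm_triangle_ineq4[of "(x \<bullet> G x) *\<^sub>R x" "G x"] that by simp
    then show ?thesis
      using Cauchy_Schwarz_ineq2[of x "G x"] G[OF that] that by simp
  qed
  moreover have "norm (odef A x - odef A y) \<le> (2 * M + 2 * L') * norm (x - y)"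
    if xy: "norm x = 1" "norm y = 1" for x y
  proof -
    have eq: "odef A x - odef A y = (x \<bullet> G x) *\<^sub>R (x - y) + ((x - y) \<bullet> G x) *\<^sub>R y
        + (y \<bullet> (G x - G y)) *\<^sub>R y - (G x - G y)"
      unfolding f[OF xy(1)] f[OF xy(2)]
      by (simp add: algebra_simps inner_diff_left inner_diff_right)
    have "norm (odef A x - odef A y) \<le> \<bar>x \<bullet> G x\<bar> * norm (x - y) + \<bar>(x - y) \<bullet> G x\<bar> * norm y
        + \<bar>y \<bullet> (G x - G y)\<bar> * norm y + norm (G x - G y)"
    proof -
      have tri: "norm (a + b + c - d) \<le> norm a + norm b + norm c + norm d" for a b c d :: "real^'n"
        using norm_triangle_ineq4[of "a + b + c" d] norm_triangle_ineq[of "a + b" c]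
          norm_triangle_ineq[of a b] by linarith
      show ?thesis
        unfolding eq by (rule order_trans[OF tri]) simp
    qed
    also have "\<dots> \<le> M * norm (x - y) + norm (x - y) * M * 1 + norm (G x - G y) * 1 + norm (G x - G y)"
    proof (intro add_mono mult_mono)
      show "\<bar>x \<bullet> G x\<bar> \<le> M" using Cauchy_Schwarz_ineq2[of x "G x"] G[OF xy(1)] xy by simp
      show "\<bar>(x - y) \<bullet> G x\<bar> \<le> norm (x - y) * M"
        by (rule order_trans[OF Cauchy_Schwarz_ineq2 mult_left_mono[OF G[OF xy(1)] norm_ge_zero]])
      show "\<bar>y \<bullet> (G x - G y)\<bar> \<le> norm (G x - G y)"
        using Cauchy_Schwarz_ineq2[of y "G x - G y"] xy by simp
    qed (use xy M in auto)
    also have "\<dots> = 2 * M * norm (x - y) + 2 * norm (G x - G y)" by simp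
    also have "\<dots> \<le> (2 * M + 2 * L') * norm (x - y)"
      using GL[OF xy] by (simp add: algebra_simps)
    finally show ?thesis .
  qed
  ultimately have "(2 * (2 * M + 2 * L') + 2 * M)-lipschitz_on UNIV (odef A)"
    using M by (intro homogeneous_lipschitz odef_scaleR) auto
  then show ?thesis by blast
qed

lemma global_solution: "\<exists>y. is_sol A {0..} y \<and> y 0 = y0"
proof -
  obtain L where "L-lipschitz_on UNIV (odef A)" using odef_lipschitz by blast
  then obtain y where "y 0 = y0"
      "\<And>t. t \<ge> 0 \<Longrightarrow> (y has_vector_derivative odef A (y t)) (at t within {0..})"
    using lipschitz_ode_global_solution by blast
  then show ?thesis by (auto simp: is_sol_def)
qed

section \<open>Linearisation at a stationary point\<close>

lemma Jac_derivative:
  assumes "v \<noteq> 0"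
  shows "((\<lambda>w. A w *v w) has_derivative (\<lambda>h. Jac A v *v h)) (at v)"
proof -
  obtain D where "\<And>x. x \<noteq> 0 \<Longrightarrow> (A has_derivative blinfun_apply (D x)) (at x)"
    using derivative_A by blast
  from bounded_bilinear.FDERIV[OF bounded_bilinear_matrix_vector_mult this[OF assms] has_derivative_ident]
  have "(\<lambda>w. A w *v w) differentiable (at v)"
    by (auto simp: differentiable_def)
  then have G: "((\<lambda>w. A w *v w) has_derivative frechet_derivative (\<lambda>w. A w *v w) (at v)) (at v)"
    by (simp add: frechet_derivative_works)
  moreover have "frechet_derivative (\<lambda>w. A w *v w) (at v) = (\<lambda>h. Jac A v *v h)"
    unfolding Jac_def using has_derivative_linear[OF G] by (auto simp: matrix_works[OF linear_matrix_vector_mul_eq[THEN iffD2]])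
  ultimately show ?thesis by simp
qed

text \<open>Euler's identity for the map \<open>v \<mapsto> A v v\<close>, which is homogeneous of degree one.\<close>

lemma Jac_mult_self:
  assumes "v \<noteq> 0"
  shows "Jac A v *v v = A v *v v"
proof -
  have "((\<lambda>a. a *\<^sub>R v) has_derivative (\<lambda>s. s *\<^sub>R v)) (at (1::real))"
    by (auto intro!: derivative_eq_intros)
  moreover have "((\<lambda>w. A w *v w) has_derivative (\<lambda>h. Jac A v *v h)) (at (1 *\<^sub>R v))"
    using Jac_derivative[OF assms] by simp
  ultimately have "((\<lambda>a. A (a *\<^sub>R v) *v (a *\<^sub>R v)) has_derivative (\<lambda>s. Jac A v *v (s *\<^sub>R v))) (at 1)"
    using has_derivative_compose by blast
  moreover have "A (a *\<^sub>R v) *v (a *\<^sub>R v) = a *\<^sub>R (A v *v v)" for a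
    using homog[of a v] by (cases "a = 0") (simp_all add: matrix_vector_mult_scaleR)
  ultimately have "((\<lambda>a. a *\<^sub>R (A v *v v)) has_derivative (\<lambda>s. Jac A v *v (s *\<^sub>R v))) (at 1)"
    by simp
  moreover have "((\<lambda>a. a *\<^sub>R (A v *v v)) has_derivative (\<lambda>s. s *\<^sub>R (A v *v v))) (at (1::real))"
    by (auto intro!: derivative_eq_intros)
  ultimately have "(\<lambda>s. Jac A v *v (s *\<^sub>R v)) = (\<lambda>s. s *\<^sub>R (A v *v v))"
    by (rule has_derivative_unique)
  from fun_cong[OF this, of 1] show ?thesis by simp
qed

text \<open>As \<open>v \<bullet> v = 1\<close> and \<open>A v *v v = pq A v *\<^sub>R v\<close>,
  the quotient rule gives \<open>v \<bullet> (Jac A v *v h) - pq A v * (v \<bullet> h)\<close> as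
  derivative of \<open>pq A\<close>, the coefficient of \<open>v\<close> in \<open>lin_field\<close>
  at \<open>s = 0\<close>.\<close>

lemma odef_derivative:
  assumes "stationary A v"
  shows "(odef A has_derivative (\<lambda>h. lin_field (Jac A v) v (pq A v) 0 *v h)) (at v)"
proof -
  have v: "v \<bullet> v = 1" "A v *v v = pq A v *\<^sub>R v"
    using assms by (auto simp: stationary_def odef_def norm_eq_1)
  then have "v \<noteq> 0" by auto
  note G = Jac_derivative[OF this]
  have "((\<lambda>y. ((y \<bullet> (A y *v y)) / (y \<bullet> y)) *\<^sub>R y - A y *v y) has_derivative
      (\<lambda>h. lin_field (Jac A v) v (pq A v) 0 *v h)) (at v)"
    by (rule derivative_eq_intros G refl | simp add: v)+
      (simp add: fun_eq_iff lin_field_mult v algebra_simps inner_commute)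
  then show ?thesis by (simp add: odef_def[abs_def] pq_def)
qed

lemma odef_remainder:
  assumes "stationary A v" "\<eta> > 0"
  obtains \<rho> where "\<rho> > 0"
    "\<And>h. norm h < \<rho> \<Longrightarrow> norm (odef A (v + h) - lin_field (Jac A v) v (pq A v) 0 *v h) \<le> \<eta> * norm h"
proof -
  from odef_derivative[OF assms(1), unfolded has_derivative_at_alt] assms(2)
  obtain \<rho> where "\<rho> > 0" and \<rho>: "\<And>y. norm (y - v) < \<rho> \<Longrightarrow>
      norm (odef A y - odef A v - lin_field (Jac A v) v (pq A v) 0 *v (y - v)) \<le> \<eta> * norm (y - v)"
    by blast
  moreover have "odef A v = 0" using assms(1) by (simp add: stationary_def)
  ultimately show ?thesis
    using that[OF \<open>\<rho> > 0\<close>] \<rho>[of "v + h" for h] by simp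
qed

text \<open>The ambient linearisation \<open>?B\<close> annihilates \<open>v\<close> and so admits
  no strict Lyapunov form; \<open>?M\<close> has its whole spectrum in the left half-plane and
  supplies one.\<close>

lemma stationary_stable:
  assumes v: "stationary A v"
    and simple: "simple_eigval (Jac A v) (complex_of_real (pq A v))"
    and gap: "\<forall>\<mu>\<in>eigvals (Jac A v) - {complex_of_real (pq A v)}. pq A v < Re \<mu>"
  shows "stable A v"
  unfolding stable_def
proof (intro allI impI)
  fix \<epsilon> :: real assume "\<epsilon> > 0"
  have v1: "norm v = 1" and vv: "v \<bullet> v = 1" "A v *v v = pq A v *\<^sub>R v"
    using v by (auto simp: stationary_def odef_def norm_eq_1)
  then have "v \<noteq> 0" by auto
  then have Jv: "Jac A v *v v = pq A v *\<^sub>R v" using Jac_mult_self vv by simp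
  let ?M = "lin_field (Jac A v) v (pq A v) 1" and ?B = "lin_field (Jac A v) v (pq A v) 0"
  have neg: "Re \<nu> < 0" if "\<nu> \<in> eigvals ?M" for \<nu>
    using lin_field_eigenvalue_neg[OF v1 Jv simple gap that] .
  have spec: "Re \<nu> \<noteq> 0" if "\<nu> \<in> eigvals ?M" for \<nu>
    using neg[OF that] by simp
  obtain \<beta> \<kappa> where \<beta>: "bounded_bilinear \<beta>" "\<And>x y. \<beta> x y = \<beta> y x" "\<kappa> > 0"
    "\<And>x. \<beta> x (?M *v x) \<ge> 0 * \<beta> x x + \<kappa> * (norm x)\<^sup>2"
    "\<And>x. (\<forall>\<mu>\<in>eigvals ?M. Re \<mu> < 0) \<Longrightarrow> x \<noteq> 0 \<Longrightarrow> \<beta> x x < 0"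
    by (rule lyapunov_form[of ?M 0]) (rule spec, assumption, rule that)
  have \<beta>neg: "\<beta> x x < 0" if "x \<noteq> 0" for x using \<beta>(5) neg that by blast
  interpret \<beta>: bounded_bilinear \<beta> by fact
  obtain K where K: "K > 0" "\<And>x y. \<bar>\<beta> x y\<bar> \<le> norm x * norm y * K"
    using \<beta>.pos_bounded by auto
  \<comment> \<open>The error \<open>e\<close> below is at most \<open>2 * \<eta> * norm h\<close>,
    and \<open>2 * \<eta> * K\<close> equals the margin \<kappa>.\<close>
  define \<eta> where "\<eta> = \<kappa> / (2 * K)"
  have "\<eta> > 0" using \<beta>(3) K(1) by (simp add: \<eta>_def)
  obtain \<rho> where \<rho>: "\<rho> > 0" "\<And>h. norm h < \<rho> \<Longrightarrow> norm (odef A (v + h) - ?B *v h) \<le> \<eta> * norm h"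
    using odef_remainder[OF v \<open>\<eta> > 0\<close>] by blast
  \<comment> \<open>The bound by \<eta> makes the quadratic term \<open>norm h * norm h / 2\<close>
    at most \<open>\<eta> * norm h\<close>.\<close>
  define r where "r = min \<rho> \<eta>"
  have "r > 0" using \<rho>(1) \<open>\<eta> > 0\<close> by (simp add: r_def)
  \<comment> \<open>On the sphere \<open>v \<bullet> h\<close> is quadratic in \<open>h\<close>, so \<open>?B\<close> may be replaced by \<open>?M\<close>.\<close>
  have decay: "\<beta> h (odef A (v + h)) \<ge> 0" if h: "norm (v + h) = 1" "norm h < r" for h
  proof -
    have "(v + h) \<bullet> (v + h) = 1" using h(1) by (simp add: norm_eq_1)
    then have vh: "v \<bullet> h = - (norm h)\<^sup>2 / 2"
      using vv(1) by (simp add: inner_add_left inner_add_right inner_commute power2_norm_eq_inner)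
    define e where "e = odef A (v + h) - ?M *v h"
    have "?B *v h = ?M *v h + (v \<bullet> h) *\<^sub>R v"
      by (simp add: lin_field_mult algebra_simps)
    then have "e = (odef A (v + h) - ?B *v h) + (v \<bullet> h) *\<^sub>R v"
      by (simp add: e_def)
    then have "norm e \<le> norm (odef A (v + h) - ?B *v h) + \<bar>v \<bullet> h\<bar>"
      using norm_triangle_ineq[of "odef A (v + h) - ?B *v h" "(v \<bullet> h) *\<^sub>R v"] v1 by simp
    also have "\<dots> \<le> \<eta> * norm h + norm h * norm h / 2"
      using \<rho>(2)[of h] h(2) by (simp add: r_def vh power2_eq_square)
    also have "norm h * norm h / 2 \<le> \<eta> * norm h"
    proof -
      have "norm h * norm h \<le> \<eta> * norm h"
        using h(2) by (intro mult_right_mono) (auto simp: r_def)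
      moreover have "0 \<le> norm h * norm h" by simp
      ultimately show ?thesis by linarith
    qed
    finally have e: "norm e \<le> 2 * \<eta> * norm h" by simp
    have "\<bar>\<beta> h e\<bar> \<le> norm h * (2 * \<eta> * norm h) * K"
      using e K(1) by (intro order_trans[OF K(2)] mult_right_mono mult_left_mono) auto
    also have "\<dots> = \<kappa> * (norm h)\<^sup>2"
      using K(1) by (simp add: \<eta>_def power2_eq_square)
    finally have "\<bar>\<beta> h e\<bar> \<le> \<kappa> * (norm h)\<^sup>2" .
    moreover have "\<beta> h (odef A (v + h)) = \<beta> h (?M *v h) + \<beta> h e"
      unfolding \<beta>.add_right[symmetric] by (simp add: e_def)
    ultimately show ?thesis using \<beta>(4)[of h] by simp
  qed
  have "\<exists>\<delta>>0. \<forall>h h'. norm (h 0) < \<delta>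
      \<and> (\<forall>t\<ge>0. (h has_vector_derivative h' t) (at t within {0..}))
      \<and> (\<forall>t\<ge>0. norm (h t) < r \<longrightarrow> \<beta> (h t) (h' t) \<ge> 0) \<longrightarrow> (\<forall>t\<ge>0. norm (h t) < \<epsilon>)"
    using \<beta>(1,2) \<beta>neg \<open>r > 0\<close> \<open>\<epsilon> > 0\<close> by (rule lyapunov_stability)
  then obtain \<delta> where \<delta>: "\<delta> > 0" "\<forall>h h'. norm (h 0) < \<delta>
      \<and> (\<forall>t\<ge>0. (h has_vector_derivative h' t) (at t within {0..}))
      \<and> (\<forall>t\<ge>0. norm (h t) < r \<longrightarrow> \<beta> (h t) (h' t) \<ge> 0) \<longrightarrow> (\<forall>t\<ge>0. norm (h t) < \<epsilon>)"
    by (elim exE conjE) (rule that)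
  have "dist (y t) v < \<epsilon>"
    if y0: "norm (y 0) = 1" "dist (y 0) v < \<delta>" and y: "is_sol A {0..} y" and "t \<ge> 0" for y t
  proof -
    have "norm (y 0 - v) < \<delta>" using y0(2) by (simp add: dist_norm)
    moreover have "((\<lambda>t. y t - v) has_vector_derivative odef A (y t)) (at t within {0..})" if "t \<ge> 0" for t
      using y that by (auto simp: is_sol_def intro!: derivative_eq_intros)
    moreover have "\<beta> (y t - v) (odef A (y t)) \<ge> 0" if "t \<ge> 0" "norm (y t - v) < r" for t
      using decay[of "y t - v"] odef_sphere_invariant[OF _ _ y y0(1), of t] that
      by (simp add: is_interval_ci)
    ultimately have "\<forall>t\<ge>0. norm (y t - v) < \<epsilon>"
      by (intro \<delta>(2)[rule_format, of "\<lambda>t. y t - v" "\<lambda>t. odef A (y t)"] allI impI conjI) auto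
    with \<open>t \<ge> 0\<close> have "norm (y t - v) < \<epsilon>" by blast
    then show ?thesis by (simp add: dist_norm)
  qed
  then show "\<exists>\<delta>>0. \<forall>y0. norm y0 = 1 \<and> dist y0 v < \<delta> \<longrightarrow>
        (\<exists>y. is_sol A {0..} y \<and> y 0 = y0) \<and>
        (\<forall>y. is_sol A {0..} y \<and> y 0 = y0 \<longrightarrow> (\<forall>t\<ge>0. dist (y t) v < \<epsilon>))"
    using \<delta>(1) global_solution by blast
qed

text \<open>Stability would confine to the ball of radius \<rho> a trajectory that starts close to
  \<open>v\<close> with positive \<beta>, where the form must grow.\<close>

lemma stationary_unstable:
  assumes v: "stationary A v"
    and \<mu>: "\<mu> \<in> eigvals (Jac A v)" "Re \<mu> < pq A v"
  shows "\<not> stable A v"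
proof
  assume stable: "stable A v"
  have v1: "norm v = 1" and vv: "v \<bullet> v = 1" "A v *v v = pq A v *\<^sub>R v"
    using v by (auto simp: stationary_def odef_def norm_eq_1)
  then have "v \<noteq> 0" by auto
  then have Jv: "Jac A v *v v = pq A v *\<^sub>R v" using Jac_mult_self vv by simp
  let ?B = "lin_field (Jac A v) v (pq A v) 0"
  obtain \<beta> \<kappa> \<gamma> d where \<beta>: "bounded_bilinear \<beta>" "\<And>x y. \<beta> x y = \<beta> y x" "\<kappa> > 0" "\<gamma> > 0"
    "\<And>x. \<beta> x (?B *v x) \<ge> \<gamma> * \<beta> x x + \<kappa> * (norm x)\<^sup>2"
    and d: "v \<bullet> d = 0" "\<beta> d d > 0"
    by (rule unstable_direction[OF v1 Jv \<mu>]) (rule that)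
  interpret \<beta>: bounded_bilinear \<beta> by fact
  have "d \<noteq> 0" using d(2) by (auto simp: \<beta>.zero_left)
  define u where "u = d /\<^sub>R norm d"
  have u: "v \<bullet> u = 0" "norm u = 1" "\<beta> u u > 0"
    using d \<open>d \<noteq> 0\<close> by (simp_all add: u_def \<beta>.scaleR_left \<beta>.scaleR_right)
  obtain K where K: "K > 0" "\<And>x y. \<bar>\<beta> x y\<bar> \<le> norm x * norm y * K"
    using \<beta>.pos_bounded by auto
  define \<eta> where "\<eta> = \<kappa> / K"
  have "\<eta> > 0" using \<beta>(3) K(1) by (simp add: \<eta>_def)
  obtain \<rho> where \<rho>: "\<rho> > 0" "\<And>h. norm h < \<rho> \<Longrightarrow> norm (odef A (v + h) - ?B *v h) \<le> \<eta> * norm h"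
    using odef_remainder[OF v \<open>\<eta> > 0\<close>] by blast
  have grow: "\<beta> h (odef A (v + h)) \<ge> \<gamma> * \<beta> h h" if "norm h < \<rho>" for h
  proof -
    define e where "e = odef A (v + h) - ?B *v h"
    have e: "norm e \<le> \<eta> * norm h" using \<rho>(2)[OF that] by (simp add: e_def)
    have "\<bar>\<beta> h e\<bar> \<le> norm h * (\<eta> * norm h) * K"
      using e K(1) by (intro order_trans[OF K(2)] mult_right_mono mult_left_mono) auto
    also have "\<dots> = \<kappa> * (norm h)\<^sup>2"
      using K(1) by (simp add: \<eta>_def power2_eq_square)
    finally have "\<bar>\<beta> h e\<bar> \<le> \<kappa> * (norm h)\<^sup>2" .
    moreover have "\<beta> h (odef A (v + h)) = \<beta> h (?B *v h) + \<beta> h e"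
      unfolding \<beta>.add_right[symmetric] by (simp add: e_def)
    ultimately show ?thesis using \<beta>(5)[of h] by linarith
  qed
  obtain \<delta> where \<delta>: "\<delta> > 0" "\<And>y0. norm y0 = 1 \<Longrightarrow> dist y0 v < \<delta> \<Longrightarrow>
        \<exists>y. is_sol A {0..} y \<and> y 0 = y0 \<and> (\<forall>t\<ge>0. dist (y t) v < \<rho>)"
    using stable \<rho>(1) unfolding stable_def by metis
  \<comment> \<open>The great circle through \<open>v\<close> in direction \<open>u\<close>; initial
    values must lie on the sphere, so the tangent line would not do.\<close>
  define g where "g s = cos s *\<^sub>R v + sin s *\<^sub>R u" for s
  have g1: "norm (g s) = 1" for s
  proof -
    have "u \<bullet> u = 1" using u(2) by (simp add: norm_eq_1)
    then have "g s \<bullet> g s = (cos s)\<^sup>2 + (sin s)\<^sup>2"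
      using vv(1) u(1)
      by (simp add: g_def inner_add_left inner_add_right inner_commute power2_eq_square)
    then show ?thesis by (simp add: norm_eq_1)
  qed
  have "((\<lambda>s. (cos s - 1) / s) \<longlongrightarrow> (0::real)) (at 0)" "((\<lambda>s. sin s / s) \<longlongrightarrow> (1::real)) (at 0)"
    using DERIV_cos[of "0::real"] DERIV_sin[of "0::real"] by (simp_all add: has_field_derivative_iff)
  then have "((\<lambda>s. ((cos s - 1) / s) *\<^sub>R v + (sin s / s) *\<^sub>R u) \<longlongrightarrow> 0 *\<^sub>R v + 1 *\<^sub>R u) (at 0)"
    by (intro tendsto_intros)
  moreover have "((cos s - 1) / s) *\<^sub>R v + (sin s / s) *\<^sub>R u = (1 / s) *\<^sub>R (g s - v)" for s
    by (simp add: g_def algebra_simps diff_divide_distrib)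
  ultimately have "((\<lambda>s. (1 / s) *\<^sub>R (g s - v)) \<longlongrightarrow> u) (at 0)"
    by simp
  then have "((\<lambda>s. \<beta> ((1 / s) *\<^sub>R (g s - v)) ((1 / s) *\<^sub>R (g s - v))) \<longlongrightarrow> \<beta> u u) (at 0)"
    by (intro \<beta>.tendsto)
  \<comment> \<open>The difference quotient tends to \<open>u\<close>, where \<beta> is positive,
    and the factor \<open>1 / s\<close> does not affect the sign of the form.\<close>
  then have ev1: "\<forall>\<^sub>F s in at 0. \<beta> ((1 / s) *\<^sub>R (g s - v)) ((1 / s) *\<^sub>R (g s - v)) > 0"
    using u(3) by (rule order_tendstoD)
  have "((\<lambda>s. dist (g s) v) \<longlongrightarrow> dist (g 0) v) (at 0)"
    unfolding g_def by (intro tendsto_intros)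
  then have ev2: "\<forall>\<^sub>F s in at 0. dist (g s) v < \<delta>"
    using \<delta>(1) by (intro order_tendstoD(2)) (auto simp: g_def)
  obtain s where s: "\<beta> ((1 / s) *\<^sub>R (g s - v)) ((1 / s) *\<^sub>R (g s - v)) > 0" "dist (g s) v < \<delta>"
    using eventually_happens[OF eventually_conj[OF ev1 ev2]] by (auto simp: trivial_limit_at)
  have pos: "\<beta> (g s - v) (g s - v) > 0"
    using s(1)
    by (simp add: \<beta>.scaleR_left \<beta>.scaleR_right zero_less_divide_iff not_square_less_zero)
  obtain y where y: "is_sol A {0..} y" "y 0 = g s" "\<And>t. t \<ge> 0 \<Longrightarrow> dist (y t) v < \<rho>"
    using \<delta>(2)[OF g1 s(2)] by blast
  show False
  proof (rule chetaev_instability[OF \<beta>(1,2), of "\<lambda>t. y t - v" "\<lambda>t. odef A (y t)" \<gamma> \<rho>])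
    show "((\<lambda>t. y t - v) has_vector_derivative odef A (y t)) (at t within {0..})" if "t \<ge> 0" for t
      using y that by (auto simp: is_sol_def intro!: derivative_eq_intros)
    show "\<gamma> * \<beta> (y t - v) (y t - v) \<le> \<beta> (y t - v) (odef A (y t))" if "t \<ge> 0" for t
      using grow[of "y t - v"] y(3)[OF that] by (simp add: dist_norm)
    show "norm (y t - v) \<le> \<rho>" if "t \<ge> 0" for t
      using y(3)[OF that] by (simp add: dist_norm)
    show "\<beta> (y 0 - v) (y 0 - v) > 0" using pos y(2) by simp
  qed (use \<beta>(4) in simp_all)
qed

end

theorem theorem5:
  fixes A :: "real^'n \<Rightarrow> real^'n^'n"
  assumes sym: "\<And>v. transpose (A v) = A v"
    and smooth: "C3_on (UNIV - {0}) A"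
    and homog: "\<And>\<alpha> v. \<alpha> \<noteq> 0 \<Longrightarrow> A (\<alpha> *\<^sub>R v) = A v"
  shows
    \<comment> \<open>(a)\<close>
    "(\<forall>I y t. is_interval I \<and> 0 \<in> I \<and> is_sol A I y \<and> norm (y 0) = 1 \<and> t \<in> I
        \<longrightarrow> norm (y t) = 1)
     \<comment> \<open>(b)\<close>
     \<and> (\<forall>ys. stationary A ys \<longrightarrow> norm ys = 1 \<and> (\<exists>c::real. A ys *v ys = c *\<^sub>R ys))
     \<comment> \<open>(c)\<close>
     \<and> (\<forall>v (c::real). norm v = 1 \<and> A v *v v = c *\<^sub>R v \<longrightarrow> stationary A v)
     \<comment> \<open>(d)\<close>
     \<and> (\<forall>ys. stationary A ys
          \<and> simple_eigval (Jac A ys) (complex_of_real (pq A ys))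
          \<and> (\<forall>\<mu>\<in>eigvals (Jac A ys) - {complex_of_real (pq A ys)}. pq A ys < Re \<mu>)
          \<longrightarrow> stable A ys)
     \<comment> \<open>(e)\<close>
     \<and> (\<forall>ys. stationary A ys
          \<and> (\<exists>\<mu>\<in>eigvals (Jac A ys). Re \<mu> < pq A ys)
          \<longrightarrow> \<not> stable A ys)"
  proof (intro conjI)
  interpret scaling_invariant A
    using smooth homog by unfold_locales
  show "\<forall>I y t. is_interval I \<and> 0 \<in> I \<and> is_sol A I y \<and> norm (y 0) = 1 \<and> t \<in> I
      \<longrightarrow> norm (y t) = 1"
    using odef_sphere_invariant by blast
  show "\<forall>ys. stationary A ys \<longrightarrow> norm ys = 1 \<and> (\<exists>c::real. A ys *v ys = c *\<^sub>R ys)"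
    using stationary_iff_eigenvector by blast
  show "\<forall>v (c::real). norm v = 1 \<and> A v *v v = c *\<^sub>R v \<longrightarrow> stationary A v"
    using stationary_iff_eigenvector by blast
  show "\<forall>ys. stationary A ys
        \<and> simple_eigval (Jac A ys) (complex_of_real (pq A ys))
        \<and> (\<forall>\<mu>\<in>eigvals (Jac A ys) - {complex_of_real (pq A ys)}. pq A ys < Re \<mu>)
        \<longrightarrow> stable A ys"
    using stationary_stable by blast
  show "\<forall>ys. stationary A ys
        \<and> (\<exists>\<mu>\<in>eigvals (Jac A ys). Re \<mu> < pq A ys)
        \<longrightarrow> \<not> stable A ys"
    using stationary_unstable by blast
qed

end
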